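(* Let $d_4>0$. There exists a constant $C>0$ depending only on $d_4$ such that the following holds. Let $n\ge 2$, let $N\in\{2n,3n\}$, let $p\ge 2$, and assume that $\mathbf E(X_{ij}^4)\le d_4$ for all $1\le i\le N$, $1\le j\le p$. Let $\hat{\boldsymbol\theta}$ be any estimator with values in $\mathbb R^p$ based on the first subsample $(\mathbb X_1,\mathbf Y_1)$. Then for all $\boldsymbol\theta\in\mathbb R^p$ and all $\sigma>0$, almost surely, $$\mathbf E_{\boldsymbol\theta,\sigma}\Big[\big(\hat Q_D(\hat{\boldsymbol\theta})-\|\boldsymbol\theta\|_2^2\big)^2\,\Big|\,\hat{\boldsymbol\theta}\Big]\le C\Big[\frac{\|\boldsymbol\theta\|_2^2}{n}\big(\|\hat{\boldsymbol\theta}-\boldsymbol\theta\|_2^2+\sigma^2\big)+\frac{p}{n^2}\big(\|\hat{\boldsymbol\theta}-\boldsymbol\theta\|_2^4+\sigma^4\big)\Big].$$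
   Context: Model: one observes $(\mathbb X,\mathbf Y)$ with $\mathbf Y=\mathbb X\boldsymbol\theta+\sigma\boldsymbol\xi$, where $\mathbb X=(X_{ij})$ is a random $N\times p$ matrix, $\boldsymbol\theta\in\mathbb R^p$, $\boldsymbol\xi=(\xi_1,\dots,\xi_N)\in\mathbb R^N$ is random noise and $\sigma>0$. The $N(p+1)$ random variables $X_{ij},\xi_i$ are jointly independent, with zero mean and variance $1$. $\mathbf P_{\boldsymbol\theta,\sigma}$ is the law of $(\mathbb X,\mathbf Y)$ and $\mathbf E_{\boldsymbol\theta,\sigma}$ the corresponding expectation. The sample is split (by rows) into disjoint subsamples $(\mathbb X_1,\mathbf Y_1),(\mathbb X_2,\mathbf Y_2)$ (and $(\mathbb X_3,\mathbf Y_3)$ if $N=3n$), each of size $n$. For an estimator $\hat{\boldsymbol\theta}=(\hat\theta_1,\dots,\hat\theta_p)$ based on $(\mathbb X_1,\mathbf Y_1)$ define $$a_j(\hat{\boldsymbol\theta})=\hat\theta_j^2+\frac{2\hat\theta_j}{n}\mathbf X_{2,j}^T(\mathbf Y_2-\mathbb X_2\hat{\boldsymbol\theta})+\frac1{n(n-1)}\sum_{k\ne l}X_{2,kj}X_{2,lj}\big(Y_{2,k}-\mathbf X_2^k\hat{\boldsymbol\theta}\big)\big(Y_{2,l}-\mathbf X_2^l\hat{\boldsymbol\theta}\big),\quad 1\le j\le p,$$ where $\mathbf X_{2,j}$, $\mathbf X_2^k$ and $X_{2,kj}$ are the $j$th column, the $k$th row and the $(k,j)$ entry of $\mathbb X_2$,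 $Y_{2,k}$ is the $k$th entry of $\mathbf Y_2$, and the sum is over $k\neq l$ in $\{1,\dots,n\}$. Set $\hat Q_D(\hat{\boldsymbol\theta})=\sum_{j=1}^p a_j(\hat{\boldsymbol\theta})$. *)

theory Defs
  imports "HOL-Probability.Probability"
begin

text \<open>
  Rows and columns are numbered from 0. A design matrix restricted to the rows in \<open>I\<close> is a function
  on the index pairs \<open>I \<times> {..<p}\<close>, a vector of responses (or of noise) a function on \<open>I\<close>; both
  are extensional, i.e. equal to \<open>undefined\<close> off their index set. The dimension \<open>p\<close> is a natural
  number rather than a type because the constant of the theorem must not depend on it.
\<close>

type_synonym sample = "(nat \<times> nat \<Rightarrow> real) \<times> (nat \<Rightarrow> real)"

definition sample_space :: "nat set \<Rightarrow> nat \<Rightarrow> sample measure" where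
  "sample_space I p = (\<Pi>\<^sub>M ij\<in>I \<times> {..<p}. borel) \<Otimes>\<^sub>M (\<Pi>\<^sub>M i\<in>I. borel)"

definition param_space :: "nat \<Rightarrow> (nat \<Rightarrow> real) measure" where
  "param_space p = (\<Pi>\<^sub>M j\<in>{..<p}. borel)"

text \<open>
  The \<open>N(p+1)\<close> variables \<open>X\<^sub>i\<^sub>j\<close> (left summand) and \<open>\<xi>\<^sub>i\<close> (right summand), as the coordinate functions
  on the space of pairs \<open>(X, \<xi>)\<close>.
\<close>

definition coord :: "nat \<times> nat + nat \<Rightarrow> sample \<Rightarrow> real" where
  "coord c \<omega> = (case c of Inl ij \<Rightarrow> fst \<omega> ij | Inr i \<Rightarrow> snd \<omega> i)"

text \<open>
  \<open>\<mu>\<close> is the joint law of \<open>(X, \<xi>)\<close>. Working with laws rather than with random variables on an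
  arbitrary probability space loses nothing, since the claim only concerns the law of \<open>(X, Y)\<close>, and
  it keeps the constant of the theorem from depending on the type of a sample space.
\<close>

definition design_noise_law :: "nat \<Rightarrow> nat \<Rightarrow> sample measure \<Rightarrow> bool" where
  "design_noise_law N p \<mu> \<longleftrightarrow>
     prob_space \<mu> \<and> sets \<mu> = sets (sample_space {..<N} p) \<and>
     prob_space.indep_vars \<mu> (\<lambda>_. borel) coord (({..<N} \<times> {..<p}) <+> {..<N}) \<and>
     (\<forall>c \<in> ({..<N} \<times> {..<p}) <+> {..<N}.
        integrable \<mu> (coord c) \<and> integrable \<mu> (\<lambda>\<omega>. (coord c \<omega>)\<^sup>2) \<and>
        prob_space.expectation \<mu> (coord c) = 0 \<and> prob_space.variance \<mu> (coord c) = 1)"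

definition fourth_moments_le :: "nat \<Rightarrow> nat \<Rightarrow> sample measure \<Rightarrow> real \<Rightarrow> bool" where
  "fourth_moments_le N p \<mu> d \<longleftrightarrow>
     (\<forall>i<N. \<forall>j<p. integrable \<mu> (\<lambda>\<omega>. (coord (Inl (i, j)) \<omega>) ^ 4) \<and>
        prob_space.expectation \<mu> (\<lambda>\<omega>. (coord (Inl (i, j)) \<omega>) ^ 4) \<le> d)"

definition row_prod :: "nat \<Rightarrow> (nat \<times> nat \<Rightarrow> real) \<Rightarrow> (nat \<Rightarrow> real) \<Rightarrow> nat \<Rightarrow> real" where
  "row_prod p x t i = (\<Sum>j<p. x (i, j) * t j)"

text \<open>The law of \<open>(X, Y)\<close> with \<open>Y = X \<theta> + \<sigma> \<xi>\<close>, that is \<open>P\<^sub>\<theta>\<^sub>,\<^sub>\<sigma>\<close>.\<close>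

definition data_law ::
    "nat \<Rightarrow> nat \<Rightarrow> sample measure \<Rightarrow> (nat \<Rightarrow> real) \<Rightarrow> real \<Rightarrow> sample measure" where
  "data_law N p \<mu> \<theta> \<sigma> =
     distr \<mu> (sample_space {..<N} p) (\<lambda>(x, \<xi>). (x, \<lambda>i\<in>{..<N}. row_prod p x \<theta> i + \<sigma> * \<xi> i))"

definition subsample :: "nat set \<Rightarrow> nat \<Rightarrow> sample \<Rightarrow> sample" where
  "subsample I p d = (restrict (fst d) (I \<times> {..<p}), restrict (snd d) I)"

definition residual :: "nat \<Rightarrow> (nat \<Rightarrow> real) \<Rightarrow> sample \<Rightarrow> nat \<Rightarrow> real" where
  "residual p t d k = snd d k - row_prod p (fst d) t k"

text \<open>
  \<open>I\<close> is the set of rows of the subsample \<open>d\<close>, and \<open>t\<close> is the value of the estimator (computed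
  from another subsample).
\<close>

definition a_stat :: "nat set \<Rightarrow> nat \<Rightarrow> (nat \<Rightarrow> real) \<Rightarrow> sample \<Rightarrow> nat \<Rightarrow> real" where
  "a_stat I p t d j =
     (let n = real (card I); x = fst d; r = residual p t d in
        (t j)\<^sup>2 + 2 * t j / n * (\<Sum>k\<in>I. x (k, j) * r k)
        + 1 / (n * (n - 1)) * (\<Sum>k\<in>I. \<Sum>l\<in>I - {k}. x (k, j) * x (l, j) * r k * r l))"

definition Q_D :: "nat set \<Rightarrow> nat \<Rightarrow> (nat \<Rightarrow> real) \<Rightarrow> sample \<Rightarrow> real" where
  "Q_D I p t d = (\<Sum>j<p. a_stat I p t d j)"

text \<open>
  Conditional expectation of a nonnegative variable given a random vector. It is taken in
  \<open>[0, \<infinity>]\<close>: the losses below need not be integrable, and \<^const>\<open>real_cond_exp\<close> is only meaningful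
  for integrable functions.
\<close>

definition cond_exp_given ::
    "'a measure \<Rightarrow> 'b measure \<Rightarrow> ('a \<Rightarrow> 'b) \<Rightarrow> ('a \<Rightarrow> real) \<Rightarrow> 'a \<Rightarrow> ennreal" where
  "cond_exp_given M S Z f = nn_cond_exp M (vimage_algebra (space M) Z S) (\<lambda>\<omega>. ennreal (f \<omega>))"

end

theory Submission
  imports Defs
begin

text \<open>
  Given the value \<open>t\<close> of the estimator, put \<open>u = \<theta> - t\<close> and \<open>W\<^sub>k\<^sub>j = X\<^sub>k\<^sub>j r\<^sub>k - u\<^sub>j\<close>, where \<open>r\<^sub>k\<close> is the residual of
  row \<open>k\<close>. The rows \<open>W\<^sub>k\<close> are independent and centred, and the statistic is designed so that
  \<open>Q - |\<theta>|\<^sup>2 = 2/n \<Sum>\<^sub>k \<langle>\<theta>, W\<^sub>k\<rangle> + 1/(n(n-1)) \<Sum>\<^sub>k\<^sub>\<noteq>\<^sub>l \<langle>W\<^sub>k, W\<^sub>l\<rangle>\<close>. The fourth moments give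
  \<open>E \<langle>s, W\<^sub>k\<rangle>\<^sup>2 \<le> K |s|\<^sup>2\<close> for all \<open>s\<close>, with \<open>K = 2 (3 + d) (|u|\<^sup>2 + \<sigma>\<^sup>2)\<close>. By orthogonality the second
  moment of the linear sum is at most \<open>n K |\<theta>|\<^sup>2\<close>; adding the rows one at a time, the second moment of
  the off-diagonal sum is at most \<open>2 n\<^sup>2 p K\<^sup>2\<close>. Since the two subsamples are independent, the
  conditional expectation given the estimator is the expectation with \<open>t\<close> frozen.
\<close>

section \<open>Conditional expectation with one of two independent variables frozen\<close>

text \<open>Under a product law the inner integral over \<open>Y\<close> is a function of
  \<open>X\<close>, and Tonelli shows that it has the right integral over every event determined by
  \<open>X\<close>. Independence is assumed as a product form of the joint law because
  \<open>X\<close> and \<open>Y\<close> may have different types. Since \<open>\<phi>\<close> has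
  values in \<open>ennreal\<close>, no integrability has to be checked.\<close>

lemma (in prob_space) nn_cond_exp_indep:
  assumes [measurable]: "random_variable S X" "random_variable T Y"
    and joint: "distr M (S \<Otimes>\<^sub>M T) (\<lambda>\<omega>. (X \<omega>, Y \<omega>)) = distr M S X \<Otimes>\<^sub>M distr M T Y"
    and [measurable]: "\<phi> \<in> borel_measurable (S \<Otimes>\<^sub>M T)"
  shows "AE \<omega> in M. nn_cond_exp M (vimage_algebra (space M) X S) (\<lambda>\<omega>. \<phi> (X \<omega>, Y \<omega>)) \<omega>
    = (\<integral>\<^sup>+\<omega>'. \<phi> (X \<omega>, Y \<omega>') \<partial>M)"
proof -
  let ?F = "vimage_algebra (space M) X S"
  let ?h = "\<lambda>t. \<integral>\<^sup>+y. \<phi> (t, y) \<partial>distr M T Y"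
  have X_space: "X \<in> space M \<rightarrow> space S"
    by (auto dest: measurable_space[OF assms(1)])
  interpret F: finite_measure_subalgebra M ?F
    using sets_image_in_sets[OF refl assms(1)] by unfold_locales (simp add: subalgebra_def)
  interpret Y: prob_space "distr M T Y" by (rule prob_space_distr) fact
  have XF [measurable]: "X \<in> ?F \<rightarrow>\<^sub>M S"
    by (rule measurable_vimage_algebra1) fact
  have h [measurable]: "?h \<in> borel_measurable S"
    by measurable
  have ae: "AE \<omega> in M. ?h (X \<omega>) = nn_cond_exp M ?F (\<lambda>\<omega>. \<phi> (X \<omega>, Y \<omega>)) \<omega>"
  proof (rule F.nn_cond_exp_charact)
    show "(\<lambda>\<omega>. \<phi> (X \<omega>, Y \<omega>)) \<in> borel_measurable M"
      by measurable
    show "(\<lambda>\<omega>. ?h (X \<omega>)) \<in> borel_measurable ?F"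
      by measurable
    \<comment> \<open>Each event of \<open>?F\<close> is the preimage under \<open>X\<close> of some
      \<open>B\<close>, so its indicator becomes a function of \<open>X\<close> that moves into the
      integrand.\<close>
    fix A assume "A \<in> sets ?F"
    then obtain B where A: "A = X -` B \<inter> space M" and B [measurable]: "B \<in> sets S"
      unfolding sets_vimage_algebra2[OF X_space] by auto
    have "(\<integral>\<^sup>+\<omega>\<in>A. \<phi> (X \<omega>, Y \<omega>) \<partial>M) =
        (\<integral>\<^sup>+\<omega>. (\<lambda>(t, y). \<phi> (t, y) * indicator B t) (X \<omega>, Y \<omega>) \<partial>M)"
      by (intro nn_integral_cong) (auto simp: A indicator_def)
    also have "\<dots> = (\<integral>\<^sup>+z. (\<lambda>(t, y). \<phi> (t, y) * indicator B t) z
        \<partial>distr M (S \<Otimes>\<^sub>M T) (\<lambda>\<omega>. (X \<omega>, Y \<omega>)))"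
      by (subst nn_integral_distr) simp_all
    also have "\<dots> = (\<integral>\<^sup>+t. (\<integral>\<^sup>+y. \<phi> (t, y) * indicator B t \<partial>distr M T Y) \<partial>distr M S X)"
      unfolding joint by (subst Y.nn_integral_fst[symmetric]) auto
    also have "\<dots> = (\<integral>\<^sup>+t. ?h t * indicator B t \<partial>distr M S X)"
      by (intro nn_integral_cong nn_integral_multc) auto
    also have "\<dots> = (\<integral>\<^sup>+\<omega>. ?h (X \<omega>) * indicator B (X \<omega>) \<partial>M)"
      by (rule nn_integral_distr) auto
    also have "\<dots> = (\<integral>\<^sup>+\<omega>\<in>A. ?h (X \<omega>) \<partial>M)"
      by (intro nn_integral_cong) (auto simp: A indicator_def)
    finally show "(\<integral>\<^sup>+\<omega>\<in>A. \<phi> (X \<omega>, Y \<omega>) \<partial>M) = (\<integral>\<^sup>+\<omega>\<in>A. ?h (X \<omega>) \<partial>M)" .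
  qed
  have h_eq: "?h (X \<omega>) = (\<integral>\<^sup>+\<omega>'. \<phi> (X \<omega>, Y \<omega>') \<partial>M)" if "\<omega> \<in> space M" for \<omega>
  proof -
    have [measurable]: "X \<omega> \<in> space S"
      using X_space that by auto
    show ?thesis
      by (intro nn_integral_distr) auto
  qed
  show ?thesis
    using ae AE_space by eventually_elim (simp add: h_eq)
qed

section \<open>Integrability from higher moments\<close>

text \<open>Pointwise the lower power is at most 1 plus the higher one in absolute value, and
  constants are integrable for a finite measure.\<close>

lemma (in finite_measure) integrable_power_le:
  fixes f :: "'a \<Rightarrow> real"
  assumes [measurable]: "f \<in> borel_measurable M"
    and "integrable M (\<lambda>x. f x ^ n)" "m \<le> n"
  shows "integrable M (\<lambda>x. f x ^ m)"
proof (rule Bochner_Integration.integrable_bound)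
  show "integrable M (\<lambda>x. 1 + \<bar>f x ^ n\<bar>)"
    using assms by auto
  have "\<bar>a\<bar> ^ m \<le> 1 + \<bar>a\<bar> ^ n" for a :: real
  proof (cases "\<bar>a\<bar> \<le> 1")
    case True
    then show ?thesis by (smt (verit) abs_ge_zero power_le_one zero_le_power)
  next
    case False
    then show ?thesis using power_increasing[OF \<open>m \<le> n\<close>, of "\<bar>a\<bar>"] by linarith
  qed
  then show "AE x in M. norm (f x ^ m) \<le> norm (1 + \<bar>f x ^ n\<bar>)"
    by (simp add: power_abs)
qed measurable

lemma integrable_mult_of_squares:
  fixes f g :: "'a \<Rightarrow> real"
  assumes [measurable]: "f \<in> borel_measurable M" "g \<in> borel_measurable M"
    and "integrable M (\<lambda>x. (f x)\<^sup>2)" "integrable M (\<lambda>x. (g x)\<^sup>2)"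
  shows "integrable M (\<lambda>x. f x * g x)"
proof (rule Bochner_Integration.integrable_bound)
  show "integrable M (\<lambda>x. (f x)\<^sup>2 + (g x)\<^sup>2)"
    using assms by auto
  have "\<bar>a * b\<bar> \<le> a\<^sup>2 + b\<^sup>2" for a b :: real
    using sum_squares_bound[of "\<bar>a\<bar>" "\<bar>b\<bar>"] mult_nonneg_nonneg[of "\<bar>a\<bar>" "\<bar>b\<bar>"]
    unfolding abs_mult power2_abs by linarith
  then show "AE x in M. norm (f x * g x) \<le> norm ((f x)\<^sup>2 + (g x)\<^sup>2)"
    by simp
qed measurable

lemma integrable_square_sum:
  fixes f :: "'i \<Rightarrow> 'a \<Rightarrow> real"
  assumes "\<And>i. i \<in> A \<Longrightarrow> f i \<in> borel_measurable M"
    "\<And>i. i \<in> A \<Longrightarrow> integrable M (\<lambda>x. (f i x)\<^sup>2)"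
  shows "integrable M (\<lambda>x. (\<Sum>i\<in>A. f i x)\<^sup>2)"
  unfolding power2_eq_square sum_product
  using assms by (intro Bochner_Integration.integrable_sum integrable_mult_of_squares) auto

lemma
  fixes f :: "'i \<Rightarrow> 'j \<Rightarrow> 'a \<Rightarrow> real"
  assumes "\<And>i j. i \<in> A \<Longrightarrow> j \<in> B \<Longrightarrow> integrable M (f i j)"
  shows integrable_sum2: "integrable M (\<lambda>x. \<Sum>i\<in>A. \<Sum>j\<in>B. f i j x)"
    and integral_sum2: "(\<integral>x. (\<Sum>i\<in>A. \<Sum>j\<in>B. f i j x) \<partial>M) = (\<Sum>i\<in>A. \<Sum>j\<in>B. \<integral>x. f i j x \<partial>M)"
  using assms by (simp_all add: Bochner_Integration.integrable_sum Bochner_Integration.integral_sum)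

section \<open>Blocks of independent real variables and their sigma-algebras\<close>

locale indep_reals = prob_space M for M :: "'a measure" +
  fixes Z :: "'i \<Rightarrow> 'a \<Rightarrow> real" and I :: "'i set"
  assumes indep: "indep_vars (\<lambda>_. borel) Z I"
begin

text \<open>The sigma-algebra generated by the variables with index in \<open>A\<close>. Being the
  preimage algebra of one restricted vector, it fits \<open>indep_var_restrict\<close>; independence
  of two quantities then reduces to measurability with respect to disjoint blocks.\<close>

definition info :: "'i set \<Rightarrow> 'a measure" where
  "info A = vimage_algebra (space M) (\<lambda>\<omega>. \<lambda>c\<in>A. Z c \<omega>) (\<Pi>\<^sub>M c\<in>A. borel)"

lemma space_info [simp]: "space (info A) = space M"
  by (simp add: info_def)

lemma sets_info: "sets (info A) =
    {(\<lambda>\<omega>. \<lambda>c\<in>A. Z c \<omega>) -` B \<inter> space M | B. B \<in> sets (\<Pi>\<^sub>M c\<in>A. borel)}"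
  unfolding info_def by (rule sets_vimage_algebra2) (auto simp: space_PiM)

lemma measurable_Z_info: "c \<in> A \<Longrightarrow> Z c \<in> borel_measurable (info A)"
proof -
  assume c: "c \<in> A"
  have "(\<lambda>\<omega>. \<lambda>c\<in>A. Z c \<omega>) \<in> info A \<rightarrow>\<^sub>M (\<Pi>\<^sub>M c\<in>A. borel)"
    unfolding info_def by (rule measurable_vimage_algebra1) (auto simp: space_PiM)
  from measurable_compose[OF this measurable_component_singleton[OF c]]
  show ?thesis using c by simp
qed

lemma measurable_Z: "c \<in> I \<Longrightarrow> Z c \<in> borel_measurable M"
  using indep unfolding indep_vars_def by auto

lemma sets_info_subset: "A \<subseteq> I \<Longrightarrow> sets (info A) \<subseteq> events"
  unfolding info_def
  by (rule sets_image_in_sets) (auto intro!: measurable_restrict measurable_Z)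

lemma measurable_info: "f \<in> info A \<rightarrow>\<^sub>M S \<Longrightarrow> A \<subseteq> I \<Longrightarrow> f \<in> M \<rightarrow>\<^sub>M S"
  using sets_info_subset[of A] unfolding measurable_def by auto

lemma sets_info_mono: "A \<subseteq> B \<Longrightarrow> sets (info A) \<subseteq> sets (info B)"
  unfolding info_def[of A]
  by (rule sets_image_in_sets) (auto intro!: measurable_restrict measurable_Z_info)

lemma measurable_info_mono: "f \<in> info A \<rightarrow>\<^sub>M S \<Longrightarrow> A \<subseteq> B \<Longrightarrow> f \<in> info B \<rightarrow>\<^sub>M S"
  using sets_info_mono[of A B] unfolding measurable_def by auto

lemma indep_set_info:
  assumes "A \<inter> B = {}" "A \<subseteq> I" "B \<subseteq> I"
  shows "indep_set (sets (info A)) (sets (info B))"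
  using indep_var_restrict[OF indep assms]
  unfolding indep_var_eq info_def sets_vimage_algebra by simp

text \<open>The sigma-algebras generated by \<open>f\<close> and \<open>g\<close> lie inside those
  of two disjoint blocks, and independence passes to smaller families of events.\<close>

lemma indep_var_info:
  assumes f: "f \<in> info A \<rightarrow>\<^sub>M S" and g: "g \<in> info B \<rightarrow>\<^sub>M T"
    and AB: "A \<inter> B = {}" "A \<subseteq> I" "B \<subseteq> I"
  shows "indep_var S f T g"
proof -
  have sub: "sigma_sets (space M) {h -` C \<inter> space M |C. C \<in> sets U} \<subseteq> sets (info A)"
    if "h \<in> info A \<rightarrow>\<^sub>M U" for h A and U :: "'d measure"
  proof -
    have "{h -` C \<inter> space M |C. C \<in> sets U} \<subseteq> sets (info A)"
      using measurable_sets[OF that] by auto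
    from sets.sigma_sets_subset[OF this] show ?thesis by simp
  qed
  have "indep_set (sigma_sets (space M) {f -` C \<inter> space M |C. C \<in> sets S})
      (sigma_sets (space M) {g -` C \<inter> space M |C. C \<in> sets T})"
    using indep_set_info[OF AB] sub[OF f] sub[OF g] unfolding indep_set_def
    by (elim indep_sets_mono_sets) (auto split: bool.split)
  then show ?thesis
    unfolding indep_var_eq using measurable_info[OF f] measurable_info[OF g] AB by auto
qed

text \<open>\<^const>\<open>indep_var\<close> forces both variables to have the same type, so independence of variables of
  different types is expressed through their joint law.\<close>

lemma distr_Pair_info:
  assumes f: "f \<in> info A \<rightarrow>\<^sub>M S" and g: "g \<in> info B \<rightarrow>\<^sub>M T"
    and AB: "A \<inter> B = {}" "A \<subseteq> I" "B \<subseteq> I"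
  shows "distr M (S \<Otimes>\<^sub>M T) (\<lambda>\<omega>. (f \<omega>, g \<omega>)) = distr M S f \<Otimes>\<^sub>M distr M T g"
proof (rule pair_measure_eqI[symmetric])
  have [measurable]: "f \<in> M \<rightarrow>\<^sub>M S" "g \<in> M \<rightarrow>\<^sub>M T"
    using measurable_info[OF f] measurable_info[OF g] AB by auto
  show "sigma_finite_measure (distr M S f)" "sigma_finite_measure (distr M T g)"
    by (simp_all add: prob_space_distr prob_space_imp_sigma_finite)
  show "sets (distr M S f \<Otimes>\<^sub>M distr M T g) = sets (distr M (S \<Otimes>\<^sub>M T) (\<lambda>\<omega>. (f \<omega>, g \<omega>)))"
    by simp
  fix C D assume "C \<in> sets (distr M S f)" "D \<in> sets (distr M T g)"
  then have [measurable]: "C \<in> sets S" "D \<in> sets T" by auto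
  have "f -` C \<inter> space M \<in> sets (info A)" "g -` D \<inter> space M \<in> sets (info B)"
    using measurable_sets[OF f] measurable_sets[OF g] by auto
  then have "prob ((f -` C \<inter> space M) \<inter> (g -` D \<inter> space M))
      = prob (f -` C \<inter> space M) * prob (g -` D \<inter> space M)"
    by (rule indep_setD[OF indep_set_info[OF AB]])
  moreover have "(\<lambda>\<omega>. (f \<omega>, g \<omega>)) -` (C \<times> D) \<inter> space M
      = (f -` C \<inter> space M) \<inter> (g -` D \<inter> space M)"
    by auto
  ultimately show "emeasure (distr M S f) C * emeasure (distr M T g) D
      = emeasure (distr M (S \<Otimes>\<^sub>M T) (\<lambda>\<omega>. (f \<omega>, g \<omega>))) (C \<times> D)"
    by (simp add: emeasure_distr emeasure_eq_measure ennreal_mult)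
qed

text \<open>The moment computations below use independence only through this factorisation, with the
  two factors depending on disjoint blocks.\<close>

lemma
  assumes "f \<in> borel_measurable (info A)" "g \<in> borel_measurable (info B)"
    and "A \<inter> B = {}" "A \<subseteq> I" "B \<subseteq> I"
    and "integrable M f" "integrable M g"
  shows integrable_mult_info: "integrable M (\<lambda>x. f x * g x :: real)"
    and expectation_mult_info: "expectation (\<lambda>x. f x * g x) = expectation f * expectation g"
  using indep_var_info[OF assms(1-5)] assms(6,7)
  by (auto intro: indep_var_integrable indep_var_lebesgue_integral)

section \<open>Moments of linear forms and of one row\<close>

text \<open>Induction on \<open>A\<close>. The claims are proved together because the expansion of
  the fourth power of \<open>a c * Z c + S\<close> involves the first two moments of the partial sum
  \<open>S\<close>. The factor \<open>3 + d\<close> dominates both \<open>d\<close>, needed for the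
  pure fourth power, and 3, needed for the cross term.\<close>

lemma linear_form_moments:
  fixes a :: "'i \<Rightarrow> real"
  assumes "finite A" "A \<subseteq> I"
    and mom: "\<And>c. c \<in> A \<Longrightarrow> integrable M (\<lambda>\<omega>. Z c \<omega> ^ 4)"
      "\<And>c. c \<in> A \<Longrightarrow> expectation (Z c) = 0"
      "\<And>c. c \<in> A \<Longrightarrow> expectation (\<lambda>\<omega>. (Z c \<omega>)\<^sup>2) = 1"
      "\<And>c. c \<in> A \<Longrightarrow> expectation (\<lambda>\<omega>. Z c \<omega> ^ 4) \<le> d"
    and d: "0 \<le> d"
  shows "integrable M (\<lambda>\<omega>. (\<Sum>c\<in>A. a c * Z c \<omega>) ^ 4) \<and>
    expectation (\<lambda>\<omega>. \<Sum>c\<in>A. a c * Z c \<omega>) = 0 \<and>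
    expectation (\<lambda>\<omega>. (\<Sum>c\<in>A. a c * Z c \<omega>)\<^sup>2) = (\<Sum>c\<in>A. (a c)\<^sup>2) \<and>
    expectation (\<lambda>\<omega>. (\<Sum>c\<in>A. a c * Z c \<omega>) ^ 4) \<le> (3 + d) * (\<Sum>c\<in>A. (a c)\<^sup>2)\<^sup>2"
  using assms(1,2) mom
proof (induction A rule: finite_induct)
  case empty
  then show ?case by simp
next
  case (insert c A)
  define S where "S = (\<lambda>\<omega>. \<Sum>c\<in>A. a c * Z c \<omega>)"
  let ?q = "\<Sum>c\<in>A. (a c)\<^sup>2"
  have c: "c \<in> I" and A: "A \<subseteq> I" using insert.prems by auto
  have S_info: "S \<in> borel_measurable (info A)"
    unfolding S_def by (intro borel_measurable_sum borel_measurable_times measurable_Z_info) auto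
  have Z_info: "Z c \<in> borel_measurable (info {c})"
    by (rule measurable_Z_info) simp
  have ZM: "Z c \<in> borel_measurable M" and SM: "S \<in> borel_measurable M"
    using measurable_info[OF S_info] measurable_Z c A by auto
  have IH: "integrable M (\<lambda>\<omega>. S \<omega> ^ 4)" "expectation S = 0"
      "expectation (\<lambda>\<omega>. (S \<omega>)\<^sup>2) = ?q" "expectation (\<lambda>\<omega>. S \<omega> ^ 4) \<le> (3 + d) * ?q\<^sup>2"
    using insert.IH insert.prems unfolding S_def by auto
  have Zc: "integrable M (\<lambda>\<omega>. Z c \<omega> ^ 4)" "expectation (Z c) = 0"
     "expectation (\<lambda>\<omega>. (Z c \<omega>)\<^sup>2) = 1" "expectation (\<lambda>\<omega>. Z c \<omega> ^ 4) \<le> d"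
    using insert.prems(2-5)[of c] by auto
  have Si: "integrable M (\<lambda>\<omega>. S \<omega> ^ m)" if "m \<le> 4" for m
    using integrable_power_le[OF SM IH(1) that] .
  have Zi: "integrable M (\<lambda>\<omega>. Z c \<omega> ^ m)" if "m \<le> 4" for m
    using integrable_power_le[OF ZM Zc(1) that] .
  have prod_i: "integrable M (\<lambda>\<omega>. Z c \<omega> ^ m * S \<omega> ^ k)"
    and prod_E: "expectation (\<lambda>\<omega>. Z c \<omega> ^ m * S \<omega> ^ k)
      = expectation (\<lambda>\<omega>. Z c \<omega> ^ m) * expectation (\<lambda>\<omega>. S \<omega> ^ k)"
    if "m \<le> 4" "k \<le> 4" for m k
    using insert.hyps c A
    by (intro integrable_mult_info[where A="{c}" and B=A] expectation_mult_info[where A="{c}" and B=A]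
        borel_measurable_power Z_info S_info Zi Si that; auto)+
  have sum_eq: "(\<Sum>c\<in>insert c A. a c * Z c \<omega>) = a c * Z c \<omega> + S \<omega>" for \<omega>
    using insert.hyps by (simp add: S_def)
  \<comment> \<open>Exponents 0 and 1 are kept explicit so that every term of the two expansions has
    the shape covered by \<open>prod_i\<close> and \<open>prod_E\<close>.\<close>
  have p2: "(a c * Z c \<omega> + S \<omega>)\<^sup>2 = (a c)\<^sup>2 * (Z c \<omega> ^ 2 * S \<omega> ^ 0)
      + (2 * a c) * (Z c \<omega> ^ 1 * S \<omega> ^ 1) + Z c \<omega> ^ 0 * S \<omega> ^ 2" for \<omega>
    by (simp add: power2_eq_square algebra_simps)
  have p4: "(a c * Z c \<omega> + S \<omega>) ^ 4 = (a c)^4 * (Z c \<omega> ^ 4 * S \<omega> ^ 0)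
      + (4 * (a c)^3) * (Z c \<omega> ^ 3 * S \<omega> ^ 1) + (6 * (a c)^2) * (Z c \<omega> ^ 2 * S \<omega> ^ 2)
      + (4 * a c) * (Z c \<omega> ^ 1 * S \<omega> ^ 3) + Z c \<omega> ^ 0 * S \<omega> ^ 4" for \<omega>
    by (simp add: power4_eq_xxxx power3_eq_cube power2_eq_square algebra_simps)
  have E1: "expectation (\<lambda>\<omega>. a c * Z c \<omega> + S \<omega>) = 0"
    using Si[of 1] Zi[of 1] IH(2) Zc(2) by simp
  have E2: "expectation (\<lambda>\<omega>. (a c * Z c \<omega> + S \<omega>)\<^sup>2) = (a c)\<^sup>2 + ?q"
    unfolding p2
    by (subst Bochner_Integration.integral_add,
        (intro Bochner_Integration.integrable_add integrable_mult_right prod_i; simp)+)+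
      (use prod_E[of 2 0] prod_E[of 1 1] prod_E[of 0 2] Zc IH in \<open>simp add: prob_space\<close>)
  have i4: "integrable M (\<lambda>\<omega>. (a c * Z c \<omega> + S \<omega>) ^ 4)"
    unfolding p4 by (intro Bochner_Integration.integrable_add integrable_mult_right prod_i; simp)
  \<comment> \<open>The terms with exponents 3 and 1 vanish because in each of them the factor of
    exponent 1 is centred; third moments may be nonzero.\<close>
  have "expectation (\<lambda>\<omega>. (a c * Z c \<omega> + S \<omega>) ^ 4) =
     (a c)^4 * expectation (\<lambda>\<omega>. Z c \<omega> ^ 4) + 6 * (a c)\<^sup>2 * ?q + expectation (\<lambda>\<omega>. S \<omega> ^ 4)"
    unfolding p4
    by (subst Bochner_Integration.integral_add,
        (intro Bochner_Integration.integrable_add integrable_mult_right prod_i; simp)+)+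
      (use prod_E[of 4 0] prod_E[of 3 1] prod_E[of 2 2] prod_E[of 1 3] prod_E[of 0 4] Zc IH
        in \<open>simp add: prob_space\<close>)
  \<comment> \<open>Raising 6 to \<open>2 * (3 + d)\<close> in the cross term makes the right side
    \<open>3 + d\<close> times a perfect square.\<close>
  also have "\<dots> \<le> (a c)^4 * (3 + d) + 2 * (3 + d) * (a c)\<^sup>2 * ?q + (3 + d) * ?q\<^sup>2"
  proof (intro add_mono mult_left_mono)
    have "6 * ((a c)\<^sup>2 * ?q) \<le> (2 * (3 + d)) * ((a c)\<^sup>2 * ?q)"
      using d by (intro mult_right_mono mult_nonneg_nonneg sum_nonneg) auto
    then show "6 * (a c)\<^sup>2 * ?q \<le> 2 * (3 + d) * (a c)\<^sup>2 * ?q" by (simp add: algebra_simps)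
  qed (use Zc IH in auto)
  also have "\<dots> = (3 + d) * ((a c)\<^sup>2 + ?q)\<^sup>2"
    by (simp add: power2_eq_square power4_eq_xxxx algebra_simps)
  finally show ?case
    using E1 E2 i4 insert.hyps unfolding sum_eq by simp
qed

text \<open>\<open>V\<close> is a linear form in the entries of one row, and \<open>R\<close> is the
  residual of that row when the estimation error is \<open>u\<close>. The design part of
  \<open>R\<close> is controlled jointly with \<open>V\<close> by fourth moments; the noise part is
  independent of \<open>V\<close>, so second moments of both factors control it.\<close>

lemma row_moments:
  fixes v u :: "'i \<Rightarrow> real" and \<sigma> :: real
  assumes A: "finite A" "A \<subseteq> I" and e: "e \<in> I" "e \<notin> A"
    and mom: "\<And>c. c \<in> A \<Longrightarrow> integrable M (\<lambda>\<omega>. Z c \<omega> ^ 4)"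
      "\<And>c. c \<in> A \<Longrightarrow> expectation (Z c) = 0"
      "\<And>c. c \<in> A \<Longrightarrow> expectation (\<lambda>\<omega>. (Z c \<omega>)\<^sup>2) = 1"
      "\<And>c. c \<in> A \<Longrightarrow> expectation (\<lambda>\<omega>. Z c \<omega> ^ 4) \<le> d"
    and noise: "integrable M (\<lambda>\<omega>. (Z e \<omega>)\<^sup>2)" "expectation (Z e) = 0"
      "expectation (\<lambda>\<omega>. (Z e \<omega>)\<^sup>2) = 1"
    and d: "0 \<le> d"
  defines "V \<equiv> \<lambda>\<omega>. \<Sum>c\<in>A. v c * Z c \<omega>"
    and "R \<equiv> \<lambda>\<omega>. (\<Sum>c\<in>A. u c * Z c \<omega>) + \<sigma> * Z e \<omega>"
  shows row_integrable_square: "integrable M (\<lambda>\<omega>. (V \<omega> * R \<omega>)\<^sup>2)"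
    and row_expectation: "expectation (\<lambda>\<omega>. V \<omega> * R \<omega>) = (\<Sum>c\<in>A. v c * u c)"
    and row_second_moment: "expectation (\<lambda>\<omega>. (V \<omega> * R \<omega>)\<^sup>2)
      \<le> 2 * (3 + d) * ((\<Sum>c\<in>A. (u c)\<^sup>2) + \<sigma>\<^sup>2) * (\<Sum>c\<in>A. (v c)\<^sup>2)"
proof -
  define U where "U = (\<lambda>\<omega>. \<Sum>c\<in>A. u c * Z c \<omega>)"
  let ?v = "\<Sum>c\<in>A. (v c)\<^sup>2" and ?u = "\<Sum>c\<in>A. (u c)\<^sup>2"
  have R: "R = (\<lambda>\<omega>. U \<omega> + \<sigma> * Z e \<omega>)"
    by (simp add: R_def U_def)
  have info: "V \<in> borel_measurable (info A)" "U \<in> borel_measurable (info A)"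
    unfolding V_def U_def
    by (intro borel_measurable_sum borel_measurable_times measurable_Z_info; simp)+
  have einfo: "Z e \<in> borel_measurable (info {e})"
    by (rule measurable_Z_info) simp
  have [measurable]: "V \<in> borel_measurable M" "U \<in> borel_measurable M" "Z e \<in> borel_measurable M"
    using info measurable_info A(2) measurable_Z e by auto
  have V_eq: "(\<Sum>c\<in>A. v c * Z c \<omega>) = V \<omega>" and U_eq: "(\<Sum>c\<in>A. u c * Z c \<omega>) = U \<omega>" for \<omega>
    by (simp_all add: V_def U_def)
  note mV = linear_form_moments[OF A mom d, of v, unfolded V_eq]
    and mU = linear_form_moments[OF A mom d, of u, unfolded U_eq]
  \<comment> \<open>Polarisation: \<open>V + U\<close> is again a linear form, and its second moment
    yields the mixed moment of \<open>V\<close> and \<open>U\<close>.\<close>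
  have VU: "(\<Sum>c\<in>A. (v c + u c) * Z c \<omega>) = V \<omega> + U \<omega>" for \<omega>
    by (simp add: V_def U_def distrib_right sum.distrib)
  note mVU = linear_form_moments[OF A mom d, of "\<lambda>c. v c + u c", unfolded VU]
  have V4: "integrable M (\<lambda>\<omega>. V \<omega> ^ m)" and U4: "integrable M (\<lambda>\<omega>. U \<omega> ^ m)" if "m \<le> 4" for m
    using integrable_power_le[of V 4 m] integrable_power_le[of U 4 m] mV mU that by auto
  have V2: "integrable M (\<lambda>\<omega>. (V \<omega>)\<^sup>2)" and U2: "integrable M (\<lambda>\<omega>. (U \<omega>)\<^sup>2)"
    using V4[of 2] U4[of 2] by auto
  have iVU: "integrable M (\<lambda>\<omega>. V \<omega> * U \<omega>)"
    by (intro integrable_mult_of_squares V2 U2) auto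
  have iV2U2: "integrable M (\<lambda>\<omega>. (V \<omega>)\<^sup>2 * (U \<omega>)\<^sup>2)"
    by (rule integrable_mult_of_squares) (use V4[of 4] U4[of 4] in simp_all)
  have iE: "integrable M (Z e)"
    using integrable_power_le[of "Z e" 2 1] noise by simp
  have iVE: "integrable M (\<lambda>\<omega>. V \<omega> * Z e \<omega>)"
    and EVE: "expectation (\<lambda>\<omega>. V \<omega> * Z e \<omega>) = expectation V * expectation (Z e)"
    using A e V4[of 1]
    by (intro integrable_mult_info[where A=A and B="{e}"]
        expectation_mult_info[where A=A and B="{e}"] info einfo iE; simp)+
  have iV2E2: "integrable M (\<lambda>\<omega>. (V \<omega>)\<^sup>2 * (Z e \<omega>)\<^sup>2)"
    and EV2E2: "expectation (\<lambda>\<omega>. (V \<omega>)\<^sup>2 * (Z e \<omega>)\<^sup>2)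
      = expectation (\<lambda>\<omega>. (V \<omega>)\<^sup>2) * expectation (\<lambda>\<omega>. (Z e \<omega>)\<^sup>2)"
    using A e
    by (intro integrable_mult_info[where A=A and B="{e}"]
        expectation_mult_info[where A=A and B="{e}"] borel_measurable_power info einfo V2 noise; simp)+
  have "expectation (\<lambda>\<omega>. (V \<omega> + U \<omega>)\<^sup>2) = ?v + 2 * expectation (\<lambda>\<omega>. V \<omega> * U \<omega>) + ?u"
    using V2 U2 iVU mV mU by (simp add: power2_sum mult.assoc)
  moreover have "(\<Sum>c\<in>A. (v c + u c)\<^sup>2) = ?v + 2 * (\<Sum>c\<in>A. v c * u c) + ?u"
    by (simp add: power2_sum sum.distrib sum_distrib_left mult.assoc)
  ultimately have EVU: "expectation (\<lambda>\<omega>. V \<omega> * U \<omega>) = (\<Sum>c\<in>A. v c * u c)"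
    using mVU by simp
  have "expectation (\<lambda>\<omega>. V \<omega> * R \<omega>)
      = expectation (\<lambda>\<omega>. V \<omega> * U \<omega> + \<sigma> * (V \<omega> * Z e \<omega>))"
    by (simp add: R algebra_simps)
  then show "expectation (\<lambda>\<omega>. V \<omega> * R \<omega>) = (\<Sum>c\<in>A. v c * u c)"
    using iVU iVE EVU EVE noise by simp
  \<comment> \<open>This separates \<open>U\<close>, which depends on the same entries as
    \<open>V\<close>, from the noise, which is independent of them.\<close>
  have VR: "(V \<omega> * R \<omega>)\<^sup>2 \<le> 2 * ((V \<omega>)\<^sup>2 * (U \<omega>)\<^sup>2) + 2 * \<sigma>\<^sup>2 * ((V \<omega>)\<^sup>2 * (Z e \<omega>)\<^sup>2)" for \<omega>
  proof -
    have "0 \<le> (V \<omega>)\<^sup>2 * (U \<omega> - \<sigma> * Z e \<omega>)\<^sup>2" by simp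
    then show ?thesis unfolding R by (simp add: power2_eq_square algebra_simps)
  qed
  have i_bound: "integrable M
      (\<lambda>\<omega>. 2 * ((V \<omega>)\<^sup>2 * (U \<omega>)\<^sup>2) + 2 * \<sigma>\<^sup>2 * ((V \<omega>)\<^sup>2 * (Z e \<omega>)\<^sup>2))"
    using iV2U2 iV2E2 by auto
  show int: "integrable M (\<lambda>\<omega>. (V \<omega> * R \<omega>)\<^sup>2)"
    by (rule Bochner_Integration.integrable_bound[OF i_bound]) (use VR in \<open>auto simp: R\<close>)
  \<comment> \<open>A Cauchy-Schwarz bound, obtained from 2xy \<le> x^2 + y^2 with the weights
    \<open>?u\<close> and \<open>?v\<close>, which balance the two fourth moments. Dividing by the
    weights requires both to be positive; otherwise one of the forms is zero.\<close>
  have EV2U2: "expectation (\<lambda>\<omega>. (V \<omega>)\<^sup>2 * (U \<omega>)\<^sup>2) \<le> (3 + d) * ?v * ?u"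
  proof (cases "?v = 0 \<or> ?u = 0")
    case True
    then have "(\<forall>c\<in>A. v c = 0) \<or> (\<forall>c\<in>A. u c = 0)"
      using A(1) by (simp add: sum_nonneg_eq_0_iff)
    then have "V = (\<lambda>\<omega>. 0) \<or> U = (\<lambda>\<omega>. 0)"
      by (auto simp: V_def U_def)
    then show ?thesis using True by auto
  next
    case False
    then have pos: "0 < ?v" "0 < ?u"
      using sum_nonneg[of A "\<lambda>c. (v c)\<^sup>2"] sum_nonneg[of A "\<lambda>c. (u c)\<^sup>2"] by auto
    have "2 * (?u * ?v) * ((V \<omega>)\<^sup>2 * (U \<omega>)\<^sup>2) \<le> ?u\<^sup>2 * V \<omega> ^ 4 + ?v\<^sup>2 * U \<omega> ^ 4" for \<omega>
      using zero_le_power2[of "?u * (V \<omega>)\<^sup>2 - ?v * (U \<omega>)\<^sup>2"]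
      by (simp add: power2_eq_square power4_eq_xxxx algebra_simps)
    then have "expectation (\<lambda>\<omega>. 2 * (?u * ?v) * ((V \<omega>)\<^sup>2 * (U \<omega>)\<^sup>2))
        \<le> expectation (\<lambda>\<omega>. ?u\<^sup>2 * V \<omega> ^ 4 + ?v\<^sup>2 * U \<omega> ^ 4)"
      using iV2U2 V4[of 4] U4[of 4] by (intro integral_mono) auto
    also have "\<dots> = ?u\<^sup>2 * expectation (\<lambda>\<omega>. V \<omega> ^ 4) + ?v\<^sup>2 * expectation (\<lambda>\<omega>. U \<omega> ^ 4)"
      using V4[of 4] U4[of 4] by simp
    also have "\<dots> \<le> ?u\<^sup>2 * ((3 + d) * ?v\<^sup>2) + ?v\<^sup>2 * ((3 + d) * ?u\<^sup>2)"
      using mV mU by (intro add_mono mult_left_mono) auto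
    also have "\<dots> = 2 * (?u * ?v) * ((3 + d) * ?v * ?u)"
      by (simp add: power2_eq_square)
    finally show ?thesis using pos by simp
  qed
  have "expectation (\<lambda>\<omega>. (V \<omega> * R \<omega>)\<^sup>2)
      \<le> expectation (\<lambda>\<omega>. 2 * ((V \<omega>)\<^sup>2 * (U \<omega>)\<^sup>2) + 2 * \<sigma>\<^sup>2 * ((V \<omega>)\<^sup>2 * (Z e \<omega>)\<^sup>2))"
    by (intro integral_mono int i_bound VR)
  also have "\<dots> = 2 * expectation (\<lambda>\<omega>. (V \<omega>)\<^sup>2 * (U \<omega>)\<^sup>2) + 2 * \<sigma>\<^sup>2 * ?v"
    using iV2U2 iV2E2 EV2E2 noise mV by simp
  also have "\<dots> \<le> 2 * ((3 + d) * ?v * ?u) + 2 * \<sigma>\<^sup>2 * ((3 + d) * ?v)"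
  proof (intro add_mono mult_left_mono EV2U2)
    have "0 \<le> ?v" by (intro sum_nonneg) auto
    then show "?v \<le> (3 + d) * ?v"
      using mult_right_mono[of 1 "3 + d" ?v] d by simp
  qed auto
  also have "\<dots> = 2 * (3 + d) * (?u + \<sigma>\<^sup>2) * ?v"
    by (simp add: algebra_simps)
  finally show "expectation (\<lambda>\<omega>. (V \<omega> * R \<omega>)\<^sup>2) \<le> 2 * (3 + d) * (?u + \<sigma>\<^sup>2) * ?v" .
qed

section \<open>Sums and off-diagonal sums of independent centred vectors\<close>

text \<open>The hypothesis with \<open>K\<close> bounds the covariance matrix of each vector by
  \<open>K\<close> times the identity. Adding a vector \<open>W m\<close> to the sum
  \<open>S\<close> of the earlier ones leaves no cross term in the linear bound. The off-diagonal
  sum grows by twice the inner product of \<open>W m\<close> with \<open>S\<close>, which is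
  uncorrelated with the old sum, so its second moment grows by at most
  \<open>4 * card J * p * K\<^sup>2\<close>.\<close>

lemma sum_indep_vectors_moments:
  fixes W :: "'k \<Rightarrow> nat \<Rightarrow> 'a \<Rightarrow> real" and K :: real
  assumes "finite J" "disjoint_family_on A J" "\<And>k. k \<in> J \<Longrightarrow> A k \<subseteq> I"
    and "\<And>k j. k \<in> J \<Longrightarrow> j < p \<Longrightarrow> W k j \<in> borel_measurable (info (A k))"
    and "\<And>k j. k \<in> J \<Longrightarrow> j < p \<Longrightarrow> integrable M (\<lambda>\<omega>. (W k j \<omega>)\<^sup>2)"
    and "\<And>k j. k \<in> J \<Longrightarrow> j < p \<Longrightarrow> expectation (W k j) = 0"
    and "\<And>k (s :: nat \<Rightarrow> real). k \<in> J \<Longrightarrow> expectation (\<lambda>\<omega>. (\<Sum>j<p. s j * W k j \<omega>)\<^sup>2) \<le> K * (\<Sum>j<p. (s j)\<^sup>2)"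
    and K: "0 \<le> K"
  shows "(\<forall>j<p. integrable M (\<lambda>\<omega>. (\<Sum>k\<in>J. W k j \<omega>)\<^sup>2)) \<and>
    (\<forall>s :: nat \<Rightarrow> real. expectation (\<lambda>\<omega>. (\<Sum>j<p. s j * (\<Sum>k\<in>J. W k j \<omega>))\<^sup>2) \<le> card J * K * (\<Sum>j<p. (s j)\<^sup>2)) \<and>
    integrable M (\<lambda>\<omega>. (\<Sum>k\<in>J. \<Sum>l\<in>J - {k}. \<Sum>j<p. W k j \<omega> * W l j \<omega>)\<^sup>2) \<and>
    expectation (\<lambda>\<omega>. (\<Sum>k\<in>J. \<Sum>l\<in>J - {k}. \<Sum>j<p. W k j \<omega> * W l j \<omega>)\<^sup>2) \<le> 2 * (card J)\<^sup>2 * p * K\<^sup>2"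
  using assms(1-7)
proof (induction J rule: finite_induct)
  case empty
  then show ?case by simp
next
  case (insert m J)
  define S where "S = (\<lambda>j \<omega>. \<Sum>k\<in>J. W k j \<omega>)"
  define D where "D = (\<lambda>\<omega>. \<Sum>k\<in>J. \<Sum>l\<in>J - {k}. \<Sum>j<p. W k j \<omega> * W l j \<omega>)"
  define U where "U = (\<Union>k\<in>J. A k)"
  have mU: "A m \<inter> U = {}" "A m \<subseteq> I" "U \<subseteq> I"
    using insert.prems(1,2) insert.hyps unfolding U_def disjoint_family_on_def by auto
  have "disjoint_family_on A J"
    using insert.prems(1) by (rule disjoint_family_on_mono[rotated]) auto
  then have IH: "\<And>j. j < p \<Longrightarrow> integrable M (\<lambda>\<omega>. (S j \<omega>)\<^sup>2)"
    "\<And>s :: nat \<Rightarrow> real. expectation (\<lambda>\<omega>. (\<Sum>j<p. s j * S j \<omega>)\<^sup>2) \<le> card J * K * (\<Sum>j<p. (s j)\<^sup>2)"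
    "integrable M (\<lambda>\<omega>. (D \<omega>)\<^sup>2)" "expectation (\<lambda>\<omega>. (D \<omega>)\<^sup>2) \<le> 2 * (card J)\<^sup>2 * p * K\<^sup>2"
    using insert.IH insert.prems(2-6) unfolding S_def D_def by auto
  have Wm: "\<And>j. j < p \<Longrightarrow> W m j \<in> borel_measurable (info (A m))"
    "\<And>j. j < p \<Longrightarrow> integrable M (\<lambda>\<omega>. (W m j \<omega>)\<^sup>2)"
    "\<And>j. j < p \<Longrightarrow> expectation (W m j) = 0"
    "\<And>s :: nat \<Rightarrow> real. expectation (\<lambda>\<omega>. (\<Sum>j<p. s j * W m j \<omega>)\<^sup>2) \<le> K * (\<Sum>j<p. (s j)\<^sup>2)"
    using insert.prems(3-6) by auto
  have WU: "W k j \<in> borel_measurable (info U)" if "k \<in> J" "j < p" for k j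
    using measurable_info_mono[OF insert.prems(3)[of k j], of U] that by (auto simp: U_def)
  have S_info: "S j \<in> borel_measurable (info U)" if "j < p" for j
    unfolding S_def using that by (intro borel_measurable_sum WU)
  have D_info: "D \<in> borel_measurable (info U)"
    unfolding D_def by (intro borel_measurable_sum borel_measurable_times WU) auto
  have WM [measurable]: "j < p \<Longrightarrow> W m j \<in> borel_measurable M" for j
    using measurable_info[OF Wm(1)] mU by auto
  have SM [measurable]: "j < p \<Longrightarrow> S j \<in> borel_measurable M" for j
    using measurable_info[OF S_info] mU by auto
  have DM [measurable]: "D \<in> borel_measurable M"
    using measurable_info[OF D_info] mU by auto
  have iW: "j < p \<Longrightarrow> integrable M (W m j)" for j
    using integrable_power_le[of "W m j" 2 1] Wm(2) by simp
  have iS: "j < p \<Longrightarrow> integrable M (S j)" for j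
    using integrable_power_le[of "S j" 2 1] IH(1) by simp
  have iWS: "integrable M (\<lambda>\<omega>. W m i \<omega> * S j \<omega>)"
    and EWS: "expectation (\<lambda>\<omega>. W m i \<omega> * S j \<omega>) = 0" if "i < p" "j < p" for i j
    using integrable_mult_info[OF Wm(1) S_info mU iW iS]
      expectation_mult_info[OF Wm(1) S_info mU iW iS] Wm(3) that by auto
  have iWW: "integrable M (\<lambda>\<omega>. W m i \<omega> * W m j \<omega>)" and iSS: "integrable M (\<lambda>\<omega>. S i \<omega> * S j \<omega>)"
    and iDS: "integrable M (\<lambda>\<omega>. D \<omega> * S j \<omega>)" if "i < p" "j < p" for i j
    using that by (auto intro!: integrable_mult_of_squares Wm(2) IH(1,3))
  have iWSWS: "integrable M (\<lambda>\<omega>. (W m i \<omega> * W m j \<omega>) * (S i \<omega> * S j \<omega>))"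
    and EWSWS: "expectation (\<lambda>\<omega>. (W m i \<omega> * W m j \<omega>) * (S i \<omega> * S j \<omega>))
      = expectation (\<lambda>\<omega>. W m i \<omega> * W m j \<omega>) * expectation (\<lambda>\<omega>. S i \<omega> * S j \<omega>)"
    if "i < p" "j < p" for i j
    using that
    by (intro integrable_mult_info[where A="A m" and B=U] expectation_mult_info[where A="A m" and B=U]
        borel_measurable_times Wm(1) S_info mU iWW iSS; simp)+
  \<comment> \<open>\<open>D\<close> and \<open>S j\<close> both live on the block \<open>U\<close>
    of the earlier vectors, so the centred factor \<open>W m j\<close> splits off.\<close>
  have iWDS: "integrable M (\<lambda>\<omega>. W m j \<omega> * (D \<omega> * S j \<omega>))"
    and EWDS: "expectation (\<lambda>\<omega>. W m j \<omega> * (D \<omega> * S j \<omega>)) = 0" if "j < p" for j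
    using integrable_mult_info[OF Wm(1) borel_measurable_times[OF D_info S_info] mU iW iDS]
      expectation_mult_info[OF Wm(1) borel_measurable_times[OF D_info S_info] mU iW iDS]
      Wm(3) that by auto

  have S_insert: "(\<Sum>k\<in>insert m J. W k j \<omega>) = W m j \<omega> + S j \<omega>" for j \<omega>
    using insert.hyps by (simp add: S_def)
  have sq: "integrable M (\<lambda>\<omega>. (W m j \<omega> + S j \<omega>)\<^sup>2)" if "j < p" for j
    using that Wm(2) IH(1) iWS by (simp add: power2_sum mult.assoc)

  have lin: "expectation (\<lambda>\<omega>. (\<Sum>j<p. s j * (W m j \<omega> + S j \<omega>))\<^sup>2)
      \<le> card (insert m J) * K * (\<Sum>j<p. (s j)\<^sup>2)" for s :: "nat \<Rightarrow> real"
  proof -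
    let ?a = "\<lambda>\<omega>. \<Sum>j<p. s j * W m j \<omega>" and ?b = "\<lambda>\<omega>. \<Sum>j<p. s j * S j \<omega>"
    have i: "integrable M (\<lambda>\<omega>. (?a \<omega>)\<^sup>2)" "integrable M (\<lambda>\<omega>. (?b \<omega>)\<^sup>2)"
      by (rule integrable_square_sum; simp add: power_mult_distrib Wm(2) IH(1))+
    have ab_info: "?a \<in> borel_measurable (info (A m))" "?b \<in> borel_measurable (info U)"
      by (intro borel_measurable_sum borel_measurable_times borel_measurable_const Wm(1) S_info; simp)+
    have iab: "integrable M ?a" "integrable M ?b"
      by (auto intro!: Bochner_Integration.integrable_sum simp: iW iS)
    have "expectation ?a = (\<Sum>j<p. s j * expectation (W m j))"
      by (subst Bochner_Integration.integral_sum) (auto simp: iW)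
    then have "expectation ?a = 0"
      by (simp add: Wm(3))
    then have "integrable M (\<lambda>\<omega>. ?a \<omega> * ?b \<omega>)" "expectation (\<lambda>\<omega>. ?a \<omega> * ?b \<omega>) = 0"
      using integrable_mult_info[OF ab_info mU iab] expectation_mult_info[OF ab_info mU iab] by auto
    moreover have "(\<Sum>j<p. s j * (W m j \<omega> + S j \<omega>))\<^sup>2
        = (?a \<omega>)\<^sup>2 + 2 * (?a \<omega> * ?b \<omega>) + (?b \<omega>)\<^sup>2" for \<omega>
      by (simp add: distrib_left sum.distrib power2_sum)
    ultimately have "expectation (\<lambda>\<omega>. (\<Sum>j<p. s j * (W m j \<omega> + S j \<omega>))\<^sup>2)
        = expectation (\<lambda>\<omega>. (?a \<omega>)\<^sup>2) + expectation (\<lambda>\<omega>. (?b \<omega>)\<^sup>2)"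
      using i by simp
    also have "\<dots> \<le> K * (\<Sum>j<p. (s j)\<^sup>2) + card J * K * (\<Sum>j<p. (s j)\<^sup>2)"
      by (intro add_mono Wm(4) IH(2))
    finally show ?thesis
      using insert.hyps by (simp add: algebra_simps)
  qed

  \<comment> \<open>The inner product of the new vector with the sum of the earlier ones. The
    off-diagonal sum runs over ordered pairs, so \<open>T\<close> enters it twice.\<close>
  define T where "T = (\<lambda>\<omega>. \<Sum>j<p. W m j \<omega> * S j \<omega>)"
  have D_insert: "(\<Sum>k\<in>insert m J. \<Sum>l\<in>insert m J - {k}. \<Sum>j<p. W k j \<omega> * W l j \<omega>)
      = D \<omega> + 2 * T \<omega>" for \<omega>
  proof -
    have "(\<Sum>k\<in>J. \<Sum>l\<in>insert m J - {k}. \<Sum>j<p. W k j \<omega> * W l j \<omega>)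
        = (\<Sum>k\<in>J. (\<Sum>j<p. W k j \<omega> * W m j \<omega>) + (\<Sum>l\<in>J - {k}. \<Sum>j<p. W k j \<omega> * W l j \<omega>))"
    proof (rule sum.cong[OF refl])
      fix k assume "k \<in> J"
      then have "insert m J - {k} = insert m (J - {k})" using insert.hyps by auto
      then show "(\<Sum>l\<in>insert m J - {k}. \<Sum>j<p. W k j \<omega> * W l j \<omega>) =
          (\<Sum>j<p. W k j \<omega> * W m j \<omega>) + (\<Sum>l\<in>J - {k}. \<Sum>j<p. W k j \<omega> * W l j \<omega>)"
        using insert.hyps by simp
    qed
    moreover have "(\<Sum>k\<in>J. \<Sum>j<p. W k j \<omega> * W m j \<omega>) = T \<omega>"
      unfolding T_def S_def by (subst sum.swap) (simp add: sum_distrib_left mult.commute)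
    moreover have "(\<Sum>l\<in>insert m J - {m}. \<Sum>j<p. W m j \<omega> * W l j \<omega>) = T \<omega>"
      using insert.hyps unfolding T_def S_def
      by (subst sum.swap) (simp add: sum_distrib_left)
    ultimately show ?thesis
      using insert.hyps by (simp add: sum.distrib D_def)
  qed
  have T2: "(T \<omega>)\<^sup>2 = (\<Sum>i<p. \<Sum>j<p. (W m i \<omega> * W m j \<omega>) * (S i \<omega> * S j \<omega>))" for \<omega>
    by (simp add: T_def power2_eq_square sum_product mult_ac)
  have iT2: "integrable M (\<lambda>\<omega>. (T \<omega>)\<^sup>2)"
    unfolding T2 using iWSWS by (intro integrable_sum2) auto
  have DT: "D \<omega> * T \<omega> = (\<Sum>j<p. W m j \<omega> * (D \<omega> * S j \<omega>))" for \<omega>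
    by (simp add: T_def sum_distrib_left mult_ac)
  have iDT: "integrable M (\<lambda>\<omega>. D \<omega> * T \<omega>)" and EDT: "expectation (\<lambda>\<omega>. D \<omega> * T \<omega>) = 0"
    unfolding DT using iWDS EWDS by (auto intro!: Bochner_Integration.integrable_sum)
  \<comment> \<open>The linear bound is applied to the \<open>j\<close>-th unit vector.\<close>
  have ES: "expectation (\<lambda>\<omega>. (S j \<omega>)\<^sup>2) \<le> card J * K" if "j < p" for j
  proof -
    have "(\<Sum>i<p. of_bool (i = j) * S i \<omega>) = S j \<omega>" for \<omega>
      using that by (simp add: of_bool_def if_distrib[of "\<lambda>x. x * _"] cong: if_cong)
    moreover have "(\<Sum>i<p. (of_bool (i = j) :: real)\<^sup>2) = 1"
      using that by (simp add: of_bool_def if_distrib[of "\<lambda>x. x\<^sup>2"] cong: if_cong)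
    ultimately show ?thesis
      using IH(2)[of "\<lambda>i. of_bool (i = j)"] by simp
  qed
  let ?G = "\<lambda>i j. expectation (\<lambda>\<omega>. W m i \<omega> * W m j \<omega>)"
  \<comment> \<open>The hypothesis on \<open>W m\<close> read as a bound on the quadratic form of
    its covariance matrix \<open>?G\<close>. It holds for every vector \<open>s\<close>, and below
    it is used pointwise with \<open>s\<close> the random vector \<open>S\<close>.\<close>
  have G: "(\<Sum>i<p. \<Sum>j<p. ?G i j * (s i * s j)) \<le> K * (\<Sum>j<p. (s j)\<^sup>2)" for s :: "nat \<Rightarrow> real"
  proof -
    have sq_eq: "(\<Sum>j<p. s j * W m j \<omega>)\<^sup>2 = (\<Sum>i<p. \<Sum>j<p. (s i * s j) * (W m i \<omega> * W m j \<omega>))" for \<omega>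
      by (simp add: power2_eq_square sum_product mult_ac)
    have "expectation (\<lambda>\<omega>. (\<Sum>j<p. s j * W m j \<omega>)\<^sup>2) = (\<Sum>i<p. \<Sum>j<p. (s i * s j) * ?G i j)"
      unfolding sq_eq by (subst integral_sum2) (auto simp: iWW)
    then show ?thesis
      using Wm(4)[of s] by (simp add: mult.commute)
  qed
  have "expectation (\<lambda>\<omega>. (T \<omega>)\<^sup>2) = (\<Sum>i<p. \<Sum>j<p. ?G i j * expectation (\<lambda>\<omega>. S i \<omega> * S j \<omega>))"
    unfolding T2 by (subst integral_sum2) (auto simp: EWSWS intro!: iWSWS sum.cong)
  \<comment> \<open>With \<open>?G\<close> constant, the expectation over \<open>S\<close> can be
    pulled outside, leaving the quadratic form of \<open>?G\<close> at \<open>S\<close>.\<close>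
  also have "\<dots> = expectation (\<lambda>\<omega>. \<Sum>i<p. \<Sum>j<p. ?G i j * (S i \<omega> * S j \<omega>))"
    by (subst integral_sum2) (auto simp: iSS)
  also have "\<dots> \<le> expectation (\<lambda>\<omega>. K * (\<Sum>j<p. (S j \<omega>)\<^sup>2))"
    by (intro integral_mono G integrable_sum2) (auto intro!: Bochner_Integration.integrable_sum iSS IH(1))
  also have "\<dots> = K * (\<Sum>j<p. expectation (\<lambda>\<omega>. (S j \<omega>)\<^sup>2))"
    using Bochner_Integration.integral_sum[of "{..<p}" M "\<lambda>j \<omega>. (S j \<omega>)\<^sup>2"] IH(1) by simp
  also have "\<dots> \<le> K * (\<Sum>j<p. card J * K)"
    by (intro mult_left_mono sum_mono ES K) auto
  finally have ET2: "expectation (\<lambda>\<omega>. (T \<omega>)\<^sup>2) \<le> card J * p * K\<^sup>2"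
    by (simp add: power2_eq_square algebra_simps)
  have DT2: "(D \<omega> + 2 * T \<omega>)\<^sup>2 = (D \<omega>)\<^sup>2 + 4 * (D \<omega> * T \<omega>) + 4 * (T \<omega>)\<^sup>2" for \<omega>
    by (simp add: power2_eq_square algebra_simps)
  have iD: "integrable M (\<lambda>\<omega>. (D \<omega> + 2 * T \<omega>)\<^sup>2)"
    unfolding DT2 using IH(3) iT2 iDT by auto
  have "expectation (\<lambda>\<omega>. (D \<omega> + 2 * T \<omega>)\<^sup>2)
      = expectation (\<lambda>\<omega>. (D \<omega>)\<^sup>2) + 4 * expectation (\<lambda>\<omega>. (T \<omega>)\<^sup>2)"
    unfolding DT2 using IH(3) iT2 iDT EDT by simp
  also have "\<dots> \<le> 2 * (card J)\<^sup>2 * p * K\<^sup>2 + 4 * (card J * p * K\<^sup>2)"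
    using IH(4) ET2 by simp
  \<comment> \<open>The increment 4m is covered by the growth of 2m^2 to 2(m+1)^2.\<close>
  also have "\<dots> \<le> 2 * (card J + 1)\<^sup>2 * p * K\<^sup>2"
    using K by (simp add: power2_eq_square algebra_simps)
  also have "\<dots> = 2 * (card (insert m J))\<^sup>2 * p * K\<^sup>2"
    using insert.hyps by simp
  finally show ?case
    using sq lin iD unfolding S_insert D_insert by blast
qed

end

section \<open>Measurability of subsamples and of the statistic\<close>

lemma measurable_fst_sample:
  "ij \<in> I \<times> {..<p} \<Longrightarrow> (\<lambda>d. fst d ij) \<in> borel_measurable (sample_space I p)"
  unfolding sample_space_def
  by (rule measurable_compose[OF measurable_fst measurable_component_singleton])

lemma measurable_snd_sample:
  "i \<in> I \<Longrightarrow> (\<lambda>d. snd d i) \<in> borel_measurable (sample_space I p)"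
  unfolding sample_space_def
  by (rule measurable_compose[OF measurable_snd measurable_component_singleton])

lemma measurable_subsample_comp:
  assumes "\<And>i j. i \<in> I \<Longrightarrow> j < p \<Longrightarrow> (\<lambda>\<omega>. fst (f \<omega>) (i, j)) \<in> borel_measurable M"
    and "\<And>i. i \<in> I \<Longrightarrow> (\<lambda>\<omega>. snd (f \<omega>) i) \<in> borel_measurable M"
  shows "(\<lambda>\<omega>. subsample I p (f \<omega>)) \<in> M \<rightarrow>\<^sub>M sample_space I p"
  unfolding subsample_def sample_space_def
  using assms by (intro measurable_Pair measurable_restrict) auto

lemma measurable_subsample:
  "I \<subseteq> J \<Longrightarrow> subsample I p \<in> sample_space J p \<rightarrow>\<^sub>M sample_space I p"
  by (rule measurable_subsample_comp) (auto intro: measurable_fst_sample measurable_snd_sample)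

text \<open>Freezing the estimate inside a conditional expectation requires measurability jointly in
  the estimate and the subsample.\<close>

lemma measurable_Q_D:
  "(\<lambda>(t, d). Q_D I p t d) \<in> borel_measurable (param_space p \<Otimes>\<^sub>M sample_space I p)"
proof -
  have m1: "(\<lambda>z. fst z j) \<in> borel_measurable (param_space p \<Otimes>\<^sub>M sample_space I p)"
    if "j < p" for j
    unfolding param_space_def using that
    by (intro measurable_compose[OF measurable_fst measurable_component_singleton]) auto
  have m2:
    "(\<lambda>z. fst (snd z) ij) \<in> borel_measurable (param_space p \<Otimes>\<^sub>M sample_space I p)"
    if "ij \<in> I \<times> {..<p}" for ij
    using that by (rule measurable_compose[OF measurable_snd measurable_fst_sample])
  have m3:
    "(\<lambda>z. snd (snd z) i) \<in> borel_measurable (param_space p \<Otimes>\<^sub>M sample_space I p)"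
    if "i \<in> I" for i
    using that by (rule measurable_compose[OF measurable_snd measurable_snd_sample])
  show ?thesis
    unfolding Q_D_def a_stat_def residual_def row_prod_def Let_def split_beta
    by (intro borel_measurable_sum borel_measurable_add borel_measurable_diff borel_measurable_times
        borel_measurable_divide borel_measurable_power borel_measurable_const m1 m2 m3) auto
qed

section \<open>Algebraic decomposition of the statistic\<close>

text \<open>An off-diagonal sum of products is the square of the sum minus the sum of squares; this
  is used for the shifted and for the unshifted family.\<close>

lemma offdiagonal_sum_shift:
  fixes w :: "'k \<Rightarrow> real"
  assumes "finite I"
  shows "(\<Sum>k\<in>I. \<Sum>l\<in>I - {k}. (w k + u) * (w l + u)) =
    (\<Sum>k\<in>I. \<Sum>l\<in>I - {k}. w k * w l) + (real (card I) - 1) * (2 * u * (\<Sum>k\<in>I. w k))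
      + card I * (real (card I) - 1) * u\<^sup>2"
proof -
  have off: "(\<Sum>k\<in>I. \<Sum>l\<in>I - {k}. f k * f l) = (\<Sum>k\<in>I. f k)\<^sup>2 - (\<Sum>k\<in>I. (f k)\<^sup>2)"
    for f :: "'k \<Rightarrow> real"
    using assms
    by (simp add: sum_diff1 power2_eq_square sum_product sum_subtractf)
  have sum_shift: "(\<Sum>k\<in>I. w k + u) = (\<Sum>k\<in>I. w k) + card I * u"
    by (simp add: sum.distrib)
  have sum_sq_shift: "(\<Sum>k\<in>I. (w k + u)\<^sup>2)
      = (\<Sum>k\<in>I. (w k)\<^sup>2) + 2 * u * (\<Sum>k\<in>I. w k) + card I * u\<^sup>2"
    by (simp add: power2_sum sum.distrib sum_distrib_left sum_distrib_right mult_ac)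
  show ?thesis
    unfolding off sum_shift sum_sq_shift
    by (simp add: power2_eq_square algebra_simps)
qed

text \<open>Here \<open>b\<close> is the true coefficient, so the shift is \<open>b - t j\<close>.
  The constants combine to the square of \<open>t j + (b - t j)\<close>, and the two linear terms to
  \<open>2 / card I\<close> times the same sum, times the sum of the \<open>w k\<close>. Thus the
  estimate survives only through \<open>w\<close>.\<close>

lemma a_stat_decomposition:
  assumes "finite I" "2 \<le> card I"
    and w: "\<And>k. k \<in> I \<Longrightarrow> fst d (k, j) * residual p t d k = w k + (b - t j)"
  shows "a_stat I p t d j = b\<^sup>2 + 2 / card I * (b * (\<Sum>k\<in>I. w k))
    + 1 / (card I * (real (card I) - 1)) * (\<Sum>k\<in>I. \<Sum>l\<in>I - {k}. w k * w l)"
proof -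
  let ?n = "real (card I)" and ?u = "b - t j" and ?w = "\<Sum>k\<in>I. w k"
  have n: "?n \<noteq> 0" "?n - 1 \<noteq> 0" using assms(2) by auto
  have "(\<Sum>k\<in>I. \<Sum>l\<in>I - {k}. fst d (k, j) * fst d (l, j) * residual p t d k * residual p t d l)
      = (\<Sum>k\<in>I. \<Sum>l\<in>I - {k}. (w k + ?u) * (w l + ?u))"
    by (intro sum.cong refl) (simp add: w[symmetric] mult_ac)
  moreover have "(\<Sum>k\<in>I. fst d (k, j) * residual p t d k) = ?w + ?n * ?u"
    by (simp add: w sum.distrib)
  ultimately have "a_stat I p t d j = (t j)\<^sup>2 + 2 * t j / ?n * (?w + ?n * ?u)
      + 1 / (?n * (?n - 1)) * ((\<Sum>k\<in>I. \<Sum>l\<in>I - {k}. w k * w l)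
        + (?n - 1) * (2 * ?u * ?w) + ?n * (?n - 1) * ?u\<^sup>2)"
    unfolding a_stat_def Let_def offdiagonal_sum_shift[OF assms(1)] by simp
  also have "\<dots> = (t j)\<^sup>2 + 2 * t j * (?w / ?n) + 2 * t j * ?u + ?u\<^sup>2 + 2 * ?u * (?w / ?n)
      + 1 / (?n * (?n - 1)) * (\<Sum>k\<in>I. \<Sum>l\<in>I - {k}. w k * w l)"
    using n by (simp add: distrib_left add_divide_distrib)
  also have "\<dots> = b\<^sup>2 + 2 / ?n * (b * ?w)
      + 1 / (?n * (?n - 1)) * (\<Sum>k\<in>I. \<Sum>l\<in>I - {k}. w k * w l)"
    by (simp add: power2_eq_square algebra_simps diff_divide_distrib)
  finally show ?thesis .
qed

section \<open>The data as a function of design and noise\<close>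

definition data_map ::
    "nat \<Rightarrow> nat \<Rightarrow> (nat \<Rightarrow> real) \<Rightarrow> real \<Rightarrow> sample \<Rightarrow> sample" where
  "data_map N p \<theta> \<sigma> = (\<lambda>(x, \<xi>). (x, \<lambda>i\<in>{..<N}. row_prod p x \<theta> i + \<sigma> * \<xi> i))"

text \<open>All variables, design entries and noise, that belong to the rows in \<open>I\<close>;
  disjoint sets of rows give disjoint blocks.\<close>

definition row_coords :: "nat \<Rightarrow> nat set \<Rightarrow> (nat \<times> nat + nat) set" where
  "row_coords p I = (I \<times> {..<p}) <+> I"

lemma coord_simps [simp]:
  "coord (Inl ij) = (\<lambda>\<omega>. fst \<omega> ij)" "coord (Inr i) = (\<lambda>\<omega>. snd \<omega> i)"
  by (simp_all add: coord_def fun_eq_iff)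

lemma row_coords_iff [simp]:
  "Inl (i, j) \<in> row_coords p I \<longleftrightarrow> i \<in> I \<and> j < p" "Inr i \<in> row_coords p I \<longleftrightarrow> i \<in> I"
  by (auto simp: row_coords_def)

lemma sum_row_entries: "(\<Sum>c\<in>Inl ` ({k} \<times> {..<p}). f c) = (\<Sum>j<p. f (Inl (k, j)))"
proof -
  have row: "Inl ` ({k} \<times> {..<p}) = (\<lambda>j. Inl (k, j)) ` {..<p}" by auto
  show ?thesis unfolding row by (simp add: sum.reindex inj_on_def)
qed

lemma data_law_altdef: "data_law N p \<mu> \<theta> \<sigma> = distr \<mu> (sample_space {..<N} p) (data_map N p \<theta> \<sigma>)"
  by (simp add: data_law_def data_map_def)

lemma indep_reals_design:
  "design_noise_law N p \<mu> \<Longrightarrow> indep_reals \<mu> coord (row_coords p {..<N})"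
  by (simp add: design_noise_law_def indep_reals_def indep_reals_axioms_def row_coords_def)

lemma subsample_data_map:
  assumes "I \<subseteq> {..<N}"
  shows "subsample I p (data_map N p \<theta> \<sigma> \<omega>) = subsample I p
    (fst \<omega>, \<lambda>i. row_prod p (fst \<omega>) \<theta> i + \<sigma> * snd \<omega> i)"
  using assms by (auto simp: subsample_def data_map_def split_beta fun_eq_iff restrict_def)

lemma measurable_data_map:
  assumes "sets \<mu> = sets (sample_space {..<N} p)"
  shows "data_map N p \<theta> \<sigma> \<in> \<mu> \<rightarrow>\<^sub>M sample_space {..<N} p"
proof -
  have "data_map N p \<theta> \<sigma> \<in> sample_space {..<N} p \<rightarrow>\<^sub>M sample_space {..<N} p"
    unfolding data_map_def split_beta sample_space_def[of _ p] row_prod_def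
    by (intro measurable_Pair measurable_fst measurable_restrict borel_measurable_add
        borel_measurable_sum borel_measurable_times borel_measurable_const
        measurable_fst_sample[unfolded sample_space_def]
        measurable_snd_sample[unfolded sample_space_def]) auto
  then show ?thesis
    using measurable_cong_sets[OF assms refl] by blast
qed

text \<open>Each response involves the entries and the noise of its own row alone. This yields the
  independence of the two subsamples.\<close>

lemma measurable_subsample_info:
  assumes "design_noise_law N p \<mu>" "I \<subseteq> {..<N}"
  shows "(\<lambda>\<omega>. subsample I p (data_map N p \<theta> \<sigma> \<omega>))
    \<in> indep_reals.info \<mu> coord (row_coords p I) \<rightarrow>\<^sub>M sample_space I p"
proof -
  interpret indep_reals \<mu> coord "row_coords p {..<N}"
    using assms(1) by (rule indep_reals_design)
  have x: "(\<lambda>\<omega>. fst \<omega> (i, j)) \<in> borel_measurable (info (row_coords p I))" if "i \<in> I" "j < p" for i j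
    using measurable_Z_info[of "Inl (i, j)" "row_coords p I"] that by simp
  have xi: "(\<lambda>\<omega>. snd \<omega> i) \<in> borel_measurable (info (row_coords p I))" if "i \<in> I" for i
    using measurable_Z_info[of "Inr i" "row_coords p I"] that by simp
  show ?thesis
    unfolding subsample_data_map[OF assms(2)] row_prod_def
    by (rule measurable_subsample_comp; unfold fst_conv snd_conv)
      (intro borel_measurable_add borel_measurable_sum borel_measurable_times
        borel_measurable_const x xi; simp)+
qed

section \<open>Second moment of the loss at a fixed value of the estimator\<close>

text \<open>The vector \<open>t\<close> is arbitrary but deterministic, so the independence of the
  rows is available. The loss splits into a linear sum \<open>L\<close> and an off-diagonal sum
  \<open>D\<close>, whose second moments are bounded separately.\<close>

lemma Q_D_loss_moments:
  fixes \<theta> t :: "nat \<Rightarrow> real" and \<sigma> :: real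
  assumes law: "design_noise_law N p \<mu>" and mom: "fourth_moments_le N p \<mu> d" and d: "0 \<le> d"
    and I: "I \<subseteq> {..<N}" "2 \<le> card I"
  defines "loss \<equiv> \<lambda>\<omega>. Q_D I p t (subsample I p (data_map N p \<theta> \<sigma> \<omega>)) - (\<Sum>j<p. (\<theta> j)\<^sup>2)"
    and "n \<equiv> real (card I)"
    and "K \<equiv> 2 * (3 + d) * ((\<Sum>j<p. (t j - \<theta> j)\<^sup>2) + \<sigma>\<^sup>2)"
  shows "integrable \<mu> (\<lambda>\<omega>. (loss \<omega>)\<^sup>2)"
    and "(\<integral>\<omega>. (loss \<omega>)\<^sup>2 \<partial>\<mu>) \<le> 8 / n * K * (\<Sum>j<p. (\<theta> j)\<^sup>2) + 16 / n\<^sup>2 * p * K\<^sup>2"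
proof -
  interpret indep_reals \<mu> coord "row_coords p {..<N}"
    using law by (rule indep_reals_design)
  have finI: "finite I" using I(1) finite_subset by auto
  have n: "2 \<le> n" using I(2) by (simp add: n_def)
  have K: "0 \<le> K" using d by (auto simp: K_def intro!: mult_nonneg_nonneg add_nonneg_nonneg sum_nonneg)
  define u where "u = (\<lambda>j. \<theta> j - t j)"
  have K_u: "K = 2 * (3 + d) * ((\<Sum>j<p. (u j)\<^sup>2) + \<sigma>\<^sup>2)"
    unfolding K_def u_def by (simp add: power2_commute)
  \<comment> \<open>The residual of row \<open>k\<close>: subtracting the prediction by
    \<open>t\<close> leaves the design applied to \<open>u\<close>, plus the noise.\<close>
  define R where "R = (\<lambda>(k::nat) (\<omega>::sample). (\<Sum>j<p. u j * fst \<omega> (k, j)) + \<sigma> * snd \<omega> k)"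
  define W where "W = (\<lambda>k j \<omega>. fst \<omega> (k, j) * R k \<omega> - u j)"
  have moments: "integrable \<mu> (\<lambda>\<omega>. ((\<Sum>j<p. s j * fst \<omega> (k, j)) * R k \<omega>)\<^sup>2)"
    "expectation (\<lambda>\<omega>. (\<Sum>j<p. s j * fst \<omega> (k, j)) * R k \<omega>) = (\<Sum>j<p. s j * u j)"
    "expectation (\<lambda>\<omega>. ((\<Sum>j<p. s j * fst \<omega> (k, j)) * R k \<omega>)\<^sup>2) \<le> K * (\<Sum>j<p. (s j)\<^sup>2)"
    if k: "k \<in> I" for k and s :: "nat \<Rightarrow> real"
  proof -
    let ?A = "Inl ` ({k} \<times> {..<p}) :: (nat \<times> nat + nat) set"
    \<comment> \<open>Carries a vector indexed by columns over to the design coordinates of row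
      \<open>k\<close>, as the general row lemma needs.\<close>
    let ?c = "\<lambda>(f :: nat \<Rightarrow> real) c. f (snd (projl c :: nat \<times> nat))"
    have kN: "k < N" using k I by auto
    have A: "finite ?A" "?A \<subseteq> row_coords p {..<N}" "Inr k \<in> row_coords p {..<N}" "Inr k \<notin> ?A"
      using kN by (auto simp: row_coords_def)
    have in_dom: "c \<in> ({..<N} \<times> {..<p}) <+> {..<N}" if "c \<in> insert (Inr k) ?A" for c
      using that kN by auto
    have X4: "integrable \<mu> (\<lambda>\<omega>. coord c \<omega> ^ 4)" "expectation (\<lambda>\<omega>. coord c \<omega> ^ 4) \<le> d"
      if "c \<in> ?A" for c
      using that mom kN unfolding fourth_moments_le_def by auto
    have c2: "integrable \<mu> (\<lambda>\<omega>. (coord c \<omega>)\<^sup>2)" "expectation (coord c) = 0"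
      "expectation (\<lambda>\<omega>. (coord c \<omega>)\<^sup>2) = 1" if "c \<in> insert (Inr k) ?A" for c
    proof -
      show "integrable \<mu> (\<lambda>\<omega>. (coord c \<omega>)\<^sup>2)" and E0: "expectation (coord c) = 0"
        using law in_dom[OF that] unfolding design_noise_law_def by blast+
      have "variance (coord c) = 1"
        using law in_dom[OF that] unfolding design_noise_law_def by blast
      then show "expectation (\<lambda>\<omega>. (coord c \<omega>)\<^sup>2) = 1"
        unfolding E0 by simp
    qed
    note m = row_integrable_square row_expectation row_second_moment
    have ms: "(\<Sum>c\<in>?A. ?c s c * coord c \<omega>) = (\<Sum>j<p. s j * fst \<omega> (k, j))"
      "(\<Sum>c\<in>?A. ?c u c * coord c \<omega>) + \<sigma> * coord (Inr k) \<omega> = R k \<omega>"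
      "(\<Sum>c\<in>?A. ?c s c * ?c u c) = (\<Sum>j<p. s j * u j)"
      "(\<Sum>c\<in>?A. (?c s c)\<^sup>2) = (\<Sum>j<p. (s j)\<^sup>2)"
      "2 * (3 + d) * ((\<Sum>c\<in>?A. (?c u c)\<^sup>2) + \<sigma>\<^sup>2) = K" for \<omega>
      unfolding sum_row_entries R_def K_u by simp_all
    note m = m[OF A X4(1) c2(2,3) X4(2) c2(1,2,3) d, of "?c s" "?c u" \<sigma>, unfolded ms]
    show "integrable \<mu> (\<lambda>\<omega>. ((\<Sum>j<p. s j * fst \<omega> (k, j)) * R k \<omega>)\<^sup>2)"
      "expectation (\<lambda>\<omega>. (\<Sum>j<p. s j * fst \<omega> (k, j)) * R k \<omega>) = (\<Sum>j<p. s j * u j)"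
      "expectation (\<lambda>\<omega>. ((\<Sum>j<p. s j * fst \<omega> (k, j)) * R k \<omega>)\<^sup>2) \<le> K * (\<Sum>j<p. (s j)\<^sup>2)"
      by (rule m; auto)+
  qed
  have info: "(\<lambda>\<omega>. fst \<omega> (k, j)) \<in> borel_measurable (info (row_coords p {k}))"
    "R k \<in> borel_measurable (info (row_coords p {k}))"
    "W k j \<in> borel_measurable (info (row_coords p {k}))" if "j < p" for k j
  proof -
    have x: "(\<lambda>\<omega>. fst \<omega> (k, j)) \<in> borel_measurable (info (row_coords p {k}))" if "j < p" for j
      using measurable_Z_info[of "Inl (k, j)" "row_coords p {k}"] that by simp
    have xi: "(\<lambda>\<omega>. snd \<omega> k) \<in> borel_measurable (info (row_coords p {k}))"
      using measurable_Z_info[of "Inr k" "row_coords p {k}"] by simp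
    show R: "R k \<in> borel_measurable (info (row_coords p {k}))"
      unfolding R_def
      by (intro borel_measurable_add borel_measurable_sum borel_measurable_times
          borel_measurable_const x xi) simp
    show "(\<lambda>\<omega>. fst \<omega> (k, j)) \<in> borel_measurable (info (row_coords p {k}))"
      "W k j \<in> borel_measurable (info (row_coords p {k}))"
      unfolding W_def
      by (intro borel_measurable_diff borel_measurable_times borel_measurable_const x R that)+
  qed
  have row_sub: "row_coords p {k} \<subseteq> row_coords p {..<N}" if "k \<in> I" for k
    using that I by (auto simp: row_coords_def)
  have lin: "(\<Sum>j<p. s j * W k j \<omega>) = (\<Sum>j<p. s j * fst \<omega> (k, j)) * R k \<omega> - (\<Sum>j<p. s j * u j)"
    for s k \<omega>
    by (simp add: W_def right_diff_distrib sum_subtractf sum_distrib_right mult.assoc)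
  \<comment> \<open>Column 0 serves as a witness for the column bound attached to the facts
    \<open>info\<close>, hence the case \<open>0 < p\<close>.\<close>
  have VR: "integrable \<mu> (\<lambda>\<omega>. (\<Sum>j<p. s j * fst \<omega> (k, j)) * R k \<omega>)" if "k \<in> I" "0 < p" for k s
  proof -
    have "(\<lambda>\<omega>. (\<Sum>j<p. s j * fst \<omega> (k, j)) * R k \<omega>) \<in> borel_measurable \<mu>"
      using info(2)[of 0 k] that
      by (intro measurable_info[OF _ row_sub[OF that(1)]] borel_measurable_times
          borel_measurable_sum borel_measurable_const info(1)) auto
    from integrable_power_le[OF this, of 2 1] moments(1)[OF that(1)] show ?thesis by simp
  qed
  \<comment> \<open>Unit vectors reduce facts about all linear forms of a row to facts about its
    single components.\<close>
  have unit: "(\<Sum>i<p. of_bool (i = j) * f i) = f j" if "j < p" for j and f :: "nat \<Rightarrow> real"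
    using that by (simp add: of_bool_def if_distrib[of "\<lambda>x. x * _"] cong: if_cong)
  have W1: "integrable \<mu> (\<lambda>\<omega>. (W k j \<omega>)\<^sup>2)" "expectation (W k j) = 0" if "k \<in> I" "j < p" for k j
  proof -
    let ?s = "\<lambda>i. of_bool (i = j) :: real"
    have i: "integrable \<mu> (\<lambda>\<omega>. (fst \<omega> (k, j) * R k \<omega>)\<^sup>2)" "integrable \<mu> (\<lambda>\<omega>. fst \<omega> (k, j) * R k \<omega>)"
      and E: "expectation (\<lambda>\<omega>. fst \<omega> (k, j) * R k \<omega>) = u j"
      using moments(1,2)[OF that(1), of ?s] VR[OF that(1), of ?s] that(2) unfolding unit[OF that(2)]
      by auto
    show "integrable \<mu> (\<lambda>\<omega>. (W k j \<omega>)\<^sup>2)"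
      unfolding W_def power2_diff using i by auto
    show "expectation (W k j) = 0"
      unfolding W_def using i E by (simp add: prob_space)
  qed
  \<comment> \<open>Centring lowers the second moment by the square of the mean, so the bound for
    the uncentred form persists.\<close>
  have W2: "expectation (\<lambda>\<omega>. (\<Sum>j<p. s j * W k j \<omega>)\<^sup>2) \<le> K * (\<Sum>j<p. (s j)\<^sup>2)"
    if "k \<in> I" for k and s :: "nat \<Rightarrow> real"
  proof (cases "p = 0")
    case False
    let ?V = "\<lambda>\<omega>. (\<Sum>j<p. s j * fst \<omega> (k, j)) * R k \<omega>" and ?m = "\<Sum>j<p. s j * u j"
    have "expectation (\<lambda>\<omega>. (?V \<omega> - ?m)\<^sup>2) = expectation (\<lambda>\<omega>. (?V \<omega>)\<^sup>2) - ?m\<^sup>2"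
      unfolding power2_diff
      using moments(1,2)[OF that, of s] VR[OF that, of s] False
      by (simp add: prob_space power2_eq_square)
    then show ?thesis
      using moments(3)[OF that, of s] zero_le_power2[of ?m] unfolding lin by linarith
  qed simp
  define L where "L = (\<lambda>\<omega>. \<Sum>j<p. \<theta> j * (\<Sum>k\<in>I. W k j \<omega>))"
  define D where "D = (\<lambda>\<omega>. \<Sum>k\<in>I. \<Sum>l\<in>I - {k}. \<Sum>j<p. W k j \<omega> * W l j \<omega>)"
  have disj: "disjoint_family_on (\<lambda>k. row_coords p {k}) I"
    by (auto simp: disjoint_family_on_def row_coords_def)
  note sums = sum_indep_vectors_moments[OF finI disj row_sub info(3) W1 W2 K]
  have WM: "W k j \<in> borel_measurable \<mu>" if "k \<in> I" "j < p" for k j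
    using info(3) row_sub that measurable_info by blast
  have [measurable]: "L \<in> borel_measurable \<mu>" "D \<in> borel_measurable \<mu>"
    unfolding L_def D_def
    by (intro borel_measurable_sum borel_measurable_times borel_measurable_const WM; simp)+
  have L: "integrable \<mu> (\<lambda>\<omega>. (L \<omega>)\<^sup>2)" "expectation (\<lambda>\<omega>. (L \<omega>)\<^sup>2) \<le> n * K * (\<Sum>j<p. (\<theta> j)\<^sup>2)"
  proof -
    show "integrable \<mu> (\<lambda>\<omega>. (L \<omega>)\<^sup>2)"
      unfolding L_def
    proof (rule integrable_square_sum)
      fix j assume j: "j \<in> {..<p}"
      show "(\<lambda>\<omega>. \<theta> j * (\<Sum>k\<in>I. W k j \<omega>)) \<in> borel_measurable \<mu>"
        using j by (intro borel_measurable_sum borel_measurable_times borel_measurable_const WM) auto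
      show "integrable \<mu> (\<lambda>\<omega>. (\<theta> j * (\<Sum>k\<in>I. W k j \<omega>))\<^sup>2)"
        using j sums by (simp add: power_mult_distrib)
    qed
  qed (use sums in \<open>auto simp: L_def n_def\<close>)
  have D: "integrable \<mu> (\<lambda>\<omega>. (D \<omega>)\<^sup>2)" "expectation (\<lambda>\<omega>. (D \<omega>)\<^sup>2) \<le> 2 * n\<^sup>2 * p * K\<^sup>2"
    using sums by (auto simp: D_def n_def)
  have loss: "loss \<omega> = 2 / n * L \<omega> + 1 / (n * (n - 1)) * D \<omega>" for \<omega>
  proof -
    let ?d = "subsample I p (data_map N p \<theta> \<sigma> \<omega>)"
    have x: "fst ?d (k, j) = fst \<omega> (k, j)" if "k \<in> I" "j < p" for k j
      using that unfolding subsample_data_map[OF I(1)] by (simp add: subsample_def)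
    have res: "residual p t ?d k = R k \<omega>" if "k \<in> I" for k
    proof -
      have "k < N" using that I(1) by auto
      with that show ?thesis
        by (simp add: residual_def R_def u_def subsample_def data_map_def split_beta row_prod_def
            left_diff_distrib sum_subtractf mult.commute)
    qed
    have "a_stat I p t ?d j = (\<theta> j)\<^sup>2 + 2 / n * (\<theta> j * (\<Sum>k\<in>I. W k j \<omega>))
        + 1 / (n * (n - 1)) * (\<Sum>k\<in>I. \<Sum>l\<in>I - {k}. W k j \<omega> * W l j \<omega>)" if "j < p" for j
      unfolding n_def using finI I(2)
      by (rule a_stat_decomposition) (simp add: x res that W_def u_def)
    then have "Q_D I p t ?d = (\<Sum>j<p. (\<theta> j)\<^sup>2) + 2 / n * L \<omega> + 1 / (n * (n - 1)) *
        (\<Sum>j<p. \<Sum>k\<in>I. \<Sum>l\<in>I - {k}. W k j \<omega> * W l j \<omega>)"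
      by (simp add: Q_D_def L_def sum.distrib sum_distrib_left)
    also have "(\<Sum>j<p. \<Sum>k\<in>I. \<Sum>l\<in>I - {k}. W k j \<omega> * W l j \<omega>) = D \<omega>"
      unfolding D_def by (subst sum.swap, subst sum.swap[of _ "{..<p}"]) simp
    finally show ?thesis by (simp add: loss_def)
  qed
  \<comment> \<open>Twice the squared coefficients of \<open>L\<close> and \<open>D\<close>, as (x +
    y)^2 \<le> 2x^2 + 2y^2 produces them.\<close>
  define a b where "a = 8 / n\<^sup>2" and "b = 2 / (n * (n - 1))\<^sup>2"
  have sq: "(loss \<omega>)\<^sup>2 \<le> a * (L \<omega>)\<^sup>2 + b * (D \<omega>)\<^sup>2" for \<omega>
  proof -
    have "(x + y)\<^sup>2 \<le> 2 * x\<^sup>2 + 2 * y\<^sup>2" for x y :: real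
      using zero_le_power2[of "x - y"] by (simp add: power2_eq_square algebra_simps)
    from this[of "2 / n * L \<omega>" "1 / (n * (n - 1)) * D \<omega>"] show ?thesis
      unfolding loss a_def b_def power_mult_distrib power_divide by simp
  qed
  have i: "integrable \<mu> (\<lambda>\<omega>. a * (L \<omega>)\<^sup>2 + b * (D \<omega>)\<^sup>2)"
    using L D by auto
  show i_loss: "integrable \<mu> (\<lambda>\<omega>. (loss \<omega>)\<^sup>2)"
  proof (rule Bochner_Integration.integrable_bound[OF i])
    show "(\<lambda>\<omega>. (loss \<omega>)\<^sup>2) \<in> borel_measurable \<mu>"
      unfolding loss by measurable
    show "AE \<omega> in \<mu>. norm ((loss \<omega>)\<^sup>2) \<le> norm (a * (L \<omega>)\<^sup>2 + b * (D \<omega>)\<^sup>2)"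
      using order_trans[OF sq abs_ge_self] by simp
  qed
  have "expectation (\<lambda>\<omega>. (loss \<omega>)\<^sup>2) \<le> expectation (\<lambda>\<omega>. a * (L \<omega>)\<^sup>2 + b * (D \<omega>)\<^sup>2)"
    by (intro integral_mono i_loss i sq)
  also have "\<dots> = a * expectation (\<lambda>\<omega>. (L \<omega>)\<^sup>2) + b * expectation (\<lambda>\<omega>. (D \<omega>)\<^sup>2)"
    using L D by simp
  also have "\<dots> \<le> a * (n * K * (\<Sum>j<p. (\<theta> j)\<^sup>2)) + b * (2 * n\<^sup>2 * p * K\<^sup>2)"
    by (intro add_mono mult_left_mono L D) (simp_all add: a_def b_def)
  \<comment> \<open>From \<open>2 \<le> n\<close> follows \<open>n \<le> 2 * (n - 1)\<close>, which
    trades the factor \<open>n - 1\<close> in the denominator for \<open>n\<close> at the cost of 4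
    after squaring.\<close>
  also have "b * (2 * n\<^sup>2 * p * K\<^sup>2) \<le> 16 / n\<^sup>2 * p * K\<^sup>2"
  proof -
    have "n\<^sup>2 \<le> 4 * (n - 1)\<^sup>2"
      using n power_mono[of n "2 * (n - 1)" 2] unfolding power_mult_distrib by simp
    then have "2 * (2 * n\<^sup>2) / (n * (n - 1))\<^sup>2 \<le> 16 / n\<^sup>2"
      using n by (simp add: power_mult_distrib divide_simps)
    then have "b * (2 * n\<^sup>2) * (p * K\<^sup>2) \<le> 16 / n\<^sup>2 * (p * K\<^sup>2)"
      by (intro mult_right_mono) (auto simp: b_def)
    then show ?thesis by (simp add: mult.assoc)
  qed
  also have "a * (n * K * (\<Sum>j<p. (\<theta> j)\<^sup>2)) = 8 / n * K * (\<Sum>j<p. (\<theta> j)\<^sup>2)"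
    using n by (simp add: a_def power2_eq_square)
  finally show "expectation (\<lambda>\<omega>. (loss \<omega>)\<^sup>2)
      \<le> 8 / n * K * (\<Sum>j<p. (\<theta> j)\<^sup>2) + 16 / n\<^sup>2 * p * K\<^sup>2"
    by simp
qed

section \<open>The constant of the bound\<close>

text \<open>The variables \<open>L\<close>, \<open>u\<close> and \<open>s\<close> stand for the
  squared norm of \<theta>, the squared estimation error and the squared noise level. Squaring
  \<open>K\<close> gives 16 times 4, and (u + s)^2 \<le> 2(u^2 + s^2) doubles this to 128. The
  linear term, with factor \<open>16 * (3 + d)\<close>, fits under the same constant because
  \<open>3 + d\<close> is at least 1.\<close>

lemma loss_bound_constant:
  fixes d L u s n p :: real
  assumes "0 \<le> d" "0 \<le> L" "0 \<le> u" "0 \<le> s" "0 < n" "0 \<le> p"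
  defines "K \<equiv> 2 * (3 + d) * (u + s)"
  shows "8 / n * K * L + 16 / n\<^sup>2 * p * K\<^sup>2
    \<le> 128 * (3 + d)\<^sup>2 * (L / n * (u + s) + p / n\<^sup>2 * (u\<^sup>2 + s\<^sup>2))"
proof -
  have "8 / n * K * L = 16 * (3 + d) * (L / n * (u + s))"
    by (simp add: K_def)
  also have "\<dots> \<le> 128 * (3 + d)\<^sup>2 * (L / n * (u + s))"
  proof (intro mult_right_mono)
    have "16 * (3 + d) \<le> 128 * ((3 + d) * (3 + d))"
      using assms(1) by (simp add: algebra_simps add_nonneg_nonneg)
    then show "16 * (3 + d) \<le> 128 * (3 + d)\<^sup>2" by (simp add: power2_eq_square)
  qed (use assms in auto)
  finally have A: "8 / n * K * L \<le> 128 * (3 + d)\<^sup>2 * (L / n * (u + s))" .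
  have "(u + s)\<^sup>2 \<le> 2 * (u\<^sup>2 + s\<^sup>2)"
    using zero_le_power2[of "u - s"] by (simp add: power2_eq_square algebra_simps)
  then have "64 * (3 + d)\<^sup>2 * (p / n\<^sup>2) * (u + s)\<^sup>2
      \<le> 64 * (3 + d)\<^sup>2 * (p / n\<^sup>2) * (2 * (u\<^sup>2 + s\<^sup>2))"
    using assms by (intro mult_left_mono) auto
  also have "\<dots> = 128 * (3 + d)\<^sup>2 * (p / n\<^sup>2 * (u\<^sup>2 + s\<^sup>2))"
    by simp
  also have "64 * (3 + d)\<^sup>2 * (p / n\<^sup>2) * (u + s)\<^sup>2 = 16 / n\<^sup>2 * p * K\<^sup>2"
    unfolding K_def power_mult_distrib by simp
  finally have "16 / n\<^sup>2 * p * K\<^sup>2 \<le> 128 * (3 + d)\<^sup>2 * (p / n\<^sup>2 * (u\<^sup>2 + s\<^sup>2))" .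
  with A show ?thesis by (simp add: distrib_left)
qed

lemma L2_set_power2: "(L2_set f A)\<^sup>2 = (\<Sum>j\<in>A. (f j)\<^sup>2)"
  by (simp add: L2_set_def sum_nonneg)

section \<open>From a fixed estimate to the conditional bound\<close>

lemma cond_exp_Q_D_loss_le:
  fixes \<theta> :: "nat \<Rightarrow> real" and \<sigma> :: real
  assumes law: "design_noise_law N p \<mu>" and mom: "fourth_moments_le N p \<mu> d" and d: "0 \<le> d"
    and I: "I\<^sub>1 \<subseteq> {..<N}" "I\<^sub>2 \<subseteq> {..<N}" "I\<^sub>1 \<inter> I\<^sub>2 = {}" "card I\<^sub>2 = n" "2 \<le> n"
    and est: "est \<in> sample_space I\<^sub>1 p \<rightarrow>\<^sub>M param_space p"
  defines "P \<equiv> data_law N p \<mu> \<theta> \<sigma>" and "\<theta>h \<equiv> \<lambda>d. est (subsample I\<^sub>1 p d)"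
  shows "AE \<omega> in P. cond_exp_given P (param_space p) \<theta>h
      (\<lambda>\<omega>. (Q_D I\<^sub>2 p (\<theta>h \<omega>) (subsample I\<^sub>2 p \<omega>) - (L2_set \<theta> {..<p})\<^sup>2)\<^sup>2) \<omega>
    \<le> ennreal (128 * (3 + d)\<^sup>2 *
        ((L2_set \<theta> {..<p})\<^sup>2 / real n * ((L2_set (\<lambda>j. \<theta>h \<omega> j - \<theta> j) {..<p})\<^sup>2 + \<sigma>\<^sup>2)
          + real p / (real n)\<^sup>2 * ((L2_set (\<lambda>j. \<theta>h \<omega> j - \<theta> j) {..<p}) ^ 4 + \<sigma> ^ 4)))"
proof -
  have I2: "2 \<le> card I\<^sub>2" using I by simp
  interpret \<mu>: indep_reals \<mu> coord "row_coords p {..<N}"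
    using law by (rule indep_reals_design)
  let ?S = "sample_space {..<N} p" and ?T = "data_map N p \<theta> \<sigma>"
  let ?\<phi> = "\<lambda>(t, d). ennreal ((Q_D I\<^sub>2 p t d - (L2_set \<theta> {..<p})\<^sup>2)\<^sup>2)"
  have sets_\<mu>: "sets \<mu> = sets ?S"
    using law by (simp add: design_noise_law_def)
  have T [measurable]: "?T \<in> \<mu> \<rightarrow>\<^sub>M ?S"
    using sets_\<mu> by (rule measurable_data_map)
  have P: "P = distr \<mu> ?S ?T"
    by (simp add: P_def data_law_altdef)
  interpret P: prob_space P
    unfolding P by (rule \<mu>.prob_space_distr) fact
  have \<theta>h: "\<theta>h \<in> ?S \<rightarrow>\<^sub>M param_space p" and sub2: "subsample I\<^sub>2 p \<in> ?S \<rightarrow>\<^sub>M sample_space I\<^sub>2 p"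
    unfolding \<theta>h_def using I
    by (auto intro: measurable_compose[OF measurable_subsample est] measurable_subsample)
  \<comment> \<open>Independence is shown under \<mu>, where the coordinates are independent, and
    then transported along \<open>?T\<close> to the law of the data.\<close>
  have "distr \<mu> (param_space p \<Otimes>\<^sub>M sample_space I\<^sub>2 p)
      (\<lambda>\<omega>. (\<theta>h (?T \<omega>), subsample I\<^sub>2 p (?T \<omega>)))
    = distr \<mu> (param_space p) (\<lambda>\<omega>. \<theta>h (?T \<omega>))
      \<Otimes>\<^sub>M distr \<mu> (sample_space I\<^sub>2 p) (\<lambda>\<omega>. subsample I\<^sub>2 p (?T \<omega>))"
  proof (rule \<mu>.distr_Pair_info)
    show "(\<lambda>\<omega>. \<theta>h (?T \<omega>)) \<in> \<mu>.info (row_coords p I\<^sub>1) \<rightarrow>\<^sub>M param_space p"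
      unfolding \<theta>h_def by (rule measurable_compose[OF measurable_subsample_info[OF law I(1)] est])
    show "(\<lambda>\<omega>. subsample I\<^sub>2 p (?T \<omega>)) \<in> \<mu>.info (row_coords p I\<^sub>2) \<rightarrow>\<^sub>M sample_space I\<^sub>2 p"
      by (rule measurable_subsample_info[OF law I(2)])
  qed (use I in \<open>auto simp: row_coords_def\<close>)
  then have ind: "distr P (param_space p \<Otimes>\<^sub>M sample_space I\<^sub>2 p) (\<lambda>\<omega>. (\<theta>h \<omega>, subsample I\<^sub>2 p \<omega>))
    = distr P (param_space p) \<theta>h \<Otimes>\<^sub>M distr P (sample_space I\<^sub>2 p) (subsample I\<^sub>2 p)"
    unfolding P by (simp add: distr_distr[OF _ T] \<theta>h sub2 measurable_Pair comp_def)
  have \<phi>: "?\<phi> \<in> borel_measurable (param_space p \<Otimes>\<^sub>M sample_space I\<^sub>2 p)"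
    using measurable_Q_D[where I = I\<^sub>2 and p = p] unfolding split_beta by measurable
  have \<theta>hP: "\<theta>h \<in> P \<rightarrow>\<^sub>M param_space p" and sub2P: "subsample I\<^sub>2 p \<in> P \<rightarrow>\<^sub>M sample_space I\<^sub>2 p"
    using \<theta>h sub2 by (simp_all add: P)
  have bound: "(\<integral>\<^sup>+\<omega>. ?\<phi> (t, subsample I\<^sub>2 p \<omega>) \<partial>P)
    \<le> ennreal (128 * (3 + d)\<^sup>2 *
        ((L2_set \<theta> {..<p})\<^sup>2 / real n * ((L2_set (\<lambda>j. t j - \<theta> j) {..<p})\<^sup>2 + \<sigma>\<^sup>2)
          + real p / (real n)\<^sup>2 * ((L2_set (\<lambda>j. t j - \<theta> j) {..<p}) ^ 4 + \<sigma> ^ 4)))"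
    if t: "t \<in> space (param_space p)" for t
  proof -
    let ?loss = "\<lambda>\<omega>. Q_D I\<^sub>2 p t (subsample I\<^sub>2 p (?T \<omega>)) - (\<Sum>j<p. (\<theta> j)\<^sup>2)"
    have "(\<lambda>\<omega>. (t, subsample I\<^sub>2 p \<omega>)) \<in> ?S \<rightarrow>\<^sub>M param_space p \<Otimes>\<^sub>M sample_space I\<^sub>2 p"
      using t sub2 by (intro measurable_Pair measurable_const)
    from measurable_compose[OF this \<phi>]
    have "(\<integral>\<^sup>+\<omega>. ?\<phi> (t, subsample I\<^sub>2 p \<omega>) \<partial>P) = (\<integral>\<^sup>+\<omega>. ?\<phi> (t, subsample I\<^sub>2 p (?T \<omega>)) \<partial>\<mu>)"
      unfolding P by (intro nn_integral_distr T) simp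
    also have "\<dots> = (\<integral>\<^sup>+\<omega>. ennreal ((?loss \<omega>)\<^sup>2) \<partial>\<mu>)"
      by (simp add: L2_set_power2)
    \<comment> \<open>With the estimate frozen the squared loss is integrable, so the integral in
      \<open>ennreal\<close> is a real one.\<close>
    also have "\<dots> = ennreal (\<integral>\<omega>. (?loss \<omega>)\<^sup>2 \<partial>\<mu>)"
      using Q_D_loss_moments(1)[OF law mom d I(2) I2] by (intro nn_integral_eq_integral) auto
    also have "\<dots> \<le> ennreal (128 * (3 + d)\<^sup>2 *
        ((\<Sum>j<p. (\<theta> j)\<^sup>2) / real n * ((\<Sum>j<p. (t j - \<theta> j)\<^sup>2) + \<sigma>\<^sup>2)
          + real p / (real n)\<^sup>2 * ((\<Sum>j<p. (t j - \<theta> j)\<^sup>2)\<^sup>2 + (\<sigma>\<^sup>2)\<^sup>2)))"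
      using I(5) d unfolding I(4)[symmetric]
      by (intro ennreal_leI order_trans[OF Q_D_loss_moments(2)[OF law mom d I(2) I2]
            loss_bound_constant[THEN order_trans]]) (auto intro: sum_nonneg)
    finally show ?thesis
      by (simp flip: L2_set_power2)
  qed
  show ?thesis
    using P.nn_cond_exp_indep[OF \<theta>hP sub2P ind \<phi>] AE_space
  proof eventually_elim
    case (elim \<omega>)
    then show ?case
      using bound[OF measurable_space[OF \<theta>hP], of \<omega>] by (simp add: cond_exp_given_def)
  qed
qed

theorem theorem1:
  fixes d4 :: real
  assumes "d4 > 0"
  shows "\<exists>C>0. \<forall>(n::nat) (N::nat) (p::nat) (I\<^sub>1::nat set) (I\<^sub>2::nat set) (\<mu>::sample measure)
           (est::sample \<Rightarrow> nat \<Rightarrow> real) (\<theta>::nat \<Rightarrow> real) (\<sigma>::real).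
    n \<ge> 2 \<longrightarrow> N \<in> {2 * n, 3 * n} \<longrightarrow> p \<ge> 2 \<longrightarrow>
    I\<^sub>1 \<subseteq> {..<N} \<longrightarrow> I\<^sub>2 \<subseteq> {..<N} \<longrightarrow> I\<^sub>1 \<inter> I\<^sub>2 = {} \<longrightarrow> card I\<^sub>1 = n \<longrightarrow> card I\<^sub>2 = n \<longrightarrow>
    design_noise_law N p \<mu> \<longrightarrow> fourth_moments_le N p \<mu> d4 \<longrightarrow>
    est \<in> sample_space I\<^sub>1 p \<rightarrow>\<^sub>M param_space p \<longrightarrow> \<sigma> > 0 \<longrightarrow>
    (let P = data_law N p \<mu> \<theta> \<sigma>; \<theta>h = (\<lambda>d. est (subsample I\<^sub>1 p d)) in
      AE d in P.
        cond_exp_given P (param_space p) \<theta>h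
          (\<lambda>d. (Q_D I\<^sub>2 p (\<theta>h d) (subsample I\<^sub>2 p d) - (L2_set \<theta> {..<p})\<^sup>2)\<^sup>2) d
        \<le> ennreal (C *
            ((L2_set \<theta> {..<p})\<^sup>2 / real n
               * ((L2_set (\<lambda>j. \<theta>h d j - \<theta> j) {..<p})\<^sup>2 + \<sigma>\<^sup>2)
             + real p / (real n)\<^sup>2
               * ((L2_set (\<lambda>j. \<theta>h d j - \<theta> j) {..<p}) ^ 4 + \<sigma> ^ 4))))"
proof (intro exI[of _ "128 * (3 + d4)\<^sup>2"] conjI allI impI)
  \<comment> \<open>The witness comes from \<open>loss_bound_constant\<close> and involves
    \<open>d4\<close> alone.\<close>
  show "0 < 128 * (3 + d4)\<^sup>2" using assms by simp
qed (unfold Let_def, rule cond_exp_Q_D_loss_le, use assms in auto)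

end
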